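(* Let $\mathbb{R}^n$ be equipped with a Minkowski Finsler structure, with Finsler unit sphere (indicatrix) $I_0$, and suppose that its Finsler reflection law is projective. Then $I_0$ is an ellipsoid. In particular, there exists an affine transformation $\mathbb{R}^n\to\mathbb{R}^n$ sending the Minkowski Finsler structure to the standard Euclidean metric and thus sending orbits of each Finsler billiard to orbits of a Euclidean billiard with the standard reflection law (the angle of incidence equals the angle of reflection).
   Context: A Finsler structure on a manifold $M$ is a family of smooth strictly convex closed hypersurfaces $I_x\subset T_xM$ (indicatrices), centrally symmetric with respect to zero; the Finsler norm on $T_xM$ is the norm with unit sphere $I_x$. Finsler geodesics are the curves minimizing Finsler length among curves with fixed endpoints. A Finsler structure on $\mathbb{R}^n$ is Minkowski if it is translation invariant; then $I_x$ is the translate of $I_0$ and its geodesics are straight lines. Finsler reflection law. The Legendre transform $D:I_x\to T_x^*M\setminus\{0\}$ sends $v\in I_x$ to the covector $w=D(v)$ with $w(v)=1$ and $\ker w$ parallel to the tangent hyperplane $T_vI_x$. For a codimension one vector subspace $H\subset T_xM$, the Finsler reflection with respect to $H$ is the involution $I_x\to I_x$ fixing the points of $I_x\cap H$ and sending each $u\in I_x\setminus H$ to the unique $v\in I_x$, $v\neq u$, such that $D(u)-D(v)$ vanishes on $H$ (then $u,v$ lie on different sides of $H$). Equivalently, the tangent hyperplanes to $I_x$ at $u$ and at $v$ and the hyperplane $H$ are concurrent (either parallel or intersecting in a common codimension two affine subspace). Identifying vectors of $I_x$ with oriented lines through the origin of $T_xM$, it acts on oriented directions. The Finsler reflection law is projective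 if for every $x$ and every codimension one vector subspace $H\subset T_xM$ there is a line $\mathcal N\subset T_xM$ through $0$ transversal to $H$ such that the Finsler reflection with respect to $H$ acts on oriented directions as the linear involution of $T_xM$ that is the identity on $H$ and $-\mathrm{id}$ on $\mathcal N$. The Finsler billiard on a strictly convex closed hypersurface $S$ sends an oriented geodesic intersecting $S$ to the geodesic issued from its last intersection point $q$ with $S$, in the direction obtained by the Finsler reflection with respect to $T_qS$. *)

theory Defs
  imports "HOL-Analysis.Analysis"
begin

section \<open>Smooth strictly convex closed hypersurfaces\<close>

text \<open>Class \<open>C\<^sup>k\<close> on an open set, via iterated directional derivatives.\<close>

primrec Ck_on :: "nat \<Rightarrow> ('a::real_normed_vector \<Rightarrow> 'b::real_normed_vector) \<Rightarrow> 'a set \<Rightarrow> bool" where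
  "Ck_on 0 f U \<longleftrightarrow> continuous_on U f"
| "Ck_on (Suc k) f U \<longleftrightarrow>
     (\<forall>x\<in>U. f differentiable (at x)) \<and>
     (\<forall>v. Ck_on k (\<lambda>x. frechet_derivative f (at x) v) U)"

definition smooth_on :: "('a::real_normed_vector \<Rightarrow> 'b::real_normed_vector) \<Rightarrow> 'a set \<Rightarrow> bool" where
  "smooth_on f U \<longleftrightarrow> (\<forall>k. Ck_on k f U)"

definition smooth_hypersurface :: "'a::euclidean_space set \<Rightarrow> bool" where
  "smooth_hypersurface S \<longleftrightarrow>
     (\<forall>p\<in>S. \<exists>U (f :: 'a \<Rightarrow> real). open U \<and> p \<in> U \<and> smooth_on f U \<and>
        (\<forall>x\<in>U. frechet_derivative f (at x) \<noteq> (\<lambda>_. 0)) \<and>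
        S \<inter> U = {x\<in>U. f x = 0})"

text \<open>Strict convexity is meant geometrically (no segments in the boundary); no positivity of the
  second fundamental form is required.\<close>

definition strictly_convex_closed_hypersurface :: "'a::euclidean_space set \<Rightarrow> bool" where
  "strictly_convex_closed_hypersurface S \<longleftrightarrow>
     smooth_hypersurface S \<and>
     (\<exists>K. compact K \<and> interior K \<noteq> {} \<and>
          (\<forall>x\<in>K. \<forall>y\<in>K. x \<noteq> y \<longrightarrow> open_segment x y \<subseteq> interior K) \<and>
          S = frontier K)"

text \<open>The tangent space as a vector subspace: velocities at \<open>q\<close> of curves in \<open>S\<close> through \<open>q\<close>.
  Near a smooth point, curves that are merely differentiable at time \<open>0\<close> have the same
  velocities as smooth ones.\<close>

definition tangent_space :: "'a::euclidean_space set \<Rightarrow> 'a \<Rightarrow> 'a set" where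
  "tangent_space S q =
     {v. \<exists>\<gamma> :: real \<Rightarrow> 'a. \<gamma> 0 = q \<and> (\<forall>t. \<gamma> t \<in> S) \<and> (\<gamma> has_vector_derivative v) (at 0)}"


section \<open>Finsler structures on a Euclidean space\<close>

text \<open>A structure assigns to a point \<open>x\<close> the indicatrix \<open>I x\<close>; all tangent spaces are identified
  with the ambient vector space by translations.\<close>

definition finsler_structure :: "('a::euclidean_space \<Rightarrow> 'a set) \<Rightarrow> bool" where
  "finsler_structure I \<longleftrightarrow>
     (\<forall>x. strictly_convex_closed_hypersurface (I x) \<and> uminus ` I x = I x)"

definition minkowski_structure :: "('a::euclidean_space \<Rightarrow> 'a set) \<Rightarrow> bool" where
  "minkowski_structure I \<longleftrightarrow> finsler_structure I \<and> (\<forall>x y. I x = I y)"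

definition euclidean_structure :: "'a::euclidean_space \<Rightarrow> 'a set" where
  "euclidean_structure x = sphere 0 1"

definition finsler_norm :: "('a::euclidean_space \<Rightarrow> 'a set) \<Rightarrow> 'a \<Rightarrow> 'a \<Rightarrow> real" where
  "finsler_norm I x v = (THE r. 0 \<le> r \<and> (\<exists>w\<in>I x. v = r *\<^sub>R w))"

text \<open>The length takes values in \<open>[0, \<infinity>]\<close>, so that a non-rectifiable curve has infinite length
  (the Henstock-Kurzweil integral would assign it length \<open>0\<close>).\<close>

definition finsler_length ::
  "('a::euclidean_space \<Rightarrow> 'a set) \<Rightarrow> real \<Rightarrow> real \<Rightarrow> (real \<Rightarrow> 'a) \<Rightarrow> ennreal" where
  "finsler_length I a b \<gamma> =
     (\<integral>\<^sup>+ t\<in>{a..b}. ennreal (finsler_norm I (\<gamma> t) (vector_derivative \<gamma> (at t))) \<partial>lborel)"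

text \<open>Complete geodesics, parametrized by Finsler arc length.\<close>

definition finsler_geodesic :: "('a::euclidean_space \<Rightarrow> 'a set) \<Rightarrow> (real \<Rightarrow> 'a) \<Rightarrow> bool" where
  "finsler_geodesic I \<gamma> \<longleftrightarrow>
     \<gamma> C1_differentiable_on UNIV \<and>
     (\<forall>t. vector_derivative \<gamma> (at t) \<in> I (\<gamma> t)) \<and>
     (\<forall>a b c. a \<le> b \<and> c piecewise_C1_differentiable_on {a..b} \<and> c a = \<gamma> a \<and> c b = \<gamma> b \<longrightarrow>
        finsler_length I a b \<gamma> \<le> finsler_length I a b c)"


section \<open>The Finsler reflection law\<close>

text \<open>In this section \<open>J\<close> is a single indicatrix.\<close>

definition legendre :: "'a::euclidean_space set \<Rightarrow> 'a \<Rightarrow> ('a \<Rightarrow> real)" where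
  "legendre J v = (THE w. linear w \<and> w v = 1 \<and> {h. w h = 0} = tangent_space J v)"

definition finsler_reflection :: "'a::euclidean_space set \<Rightarrow> 'a set \<Rightarrow> 'a \<Rightarrow> 'a" where
  "finsler_reflection J H u =
     (if u \<in> H then u
      else (THE v. v \<in> J \<and> v \<noteq> u \<and> (\<forall>h\<in>H. legendre J u h - legendre J v h = 0)))"

text \<open>Vectors represent the same oriented direction iff they differ by a positive factor.\<close>

definition projective_reflection_law :: "('a::euclidean_space \<Rightarrow> 'a set) \<Rightarrow> bool" where
  "projective_reflection_law I \<longleftrightarrow>
     (\<forall>x H. subspace H \<and> dim H + 1 = DIM('a) \<longrightarrow>
        (\<exists>N \<sigma>. subspace N \<and> dim N = 1 \<and> H \<inter> N = {0} \<and>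
           linear \<sigma> \<and> (\<forall>h\<in>H. \<sigma> h = h) \<and> (\<forall>n\<in>N. \<sigma> n = - n) \<and>
           (\<forall>u\<in>I x. \<exists>c>0. finsler_reflection (I x) H u = c *\<^sub>R \<sigma> u)))"


section \<open>Billiards\<close>

text \<open>An oriented geodesic is represented by its arc length parametrizations. The billiard map on
  oriented geodesics is thus a relation between parametrized ones, invariant under shifts of time on
  either side; \<open>s\<close> is the time at which \<open>\<gamma>\<close> meets \<open>S\<close> for the last time.\<close>

definition finsler_billiard ::
  "('a::euclidean_space \<Rightarrow> 'a set) \<Rightarrow> 'a set \<Rightarrow> (real \<Rightarrow> 'a) \<Rightarrow> (real \<Rightarrow> 'a) \<Rightarrow> bool" where
  "finsler_billiard I S \<gamma> \<delta> \<longleftrightarrow>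
     finsler_geodesic I \<gamma> \<and> finsler_geodesic I \<delta> \<and>
     (\<exists>s t. \<gamma> s \<in> S \<and> (\<forall>r>s. \<gamma> r \<notin> S) \<and> \<delta> t = \<gamma> s \<and>
        vector_derivative \<delta> (at t) =
          finsler_reflection (I (\<gamma> s)) (tangent_space S (\<gamma> s)) (vector_derivative \<gamma> (at s)))"

definition finsler_billiard_orbit ::
  "('a::euclidean_space \<Rightarrow> 'a set) \<Rightarrow> 'a set \<Rightarrow> (nat \<Rightarrow> real \<Rightarrow> 'a) \<Rightarrow> bool" where
  "finsler_billiard_orbit I S g \<longleftrightarrow> (\<forall>k. finsler_billiard I S (g k) (g (Suc k)))"

definition reflect_along :: "'a::euclidean_space \<Rightarrow> 'a \<Rightarrow> 'a" where
  "reflect_along \<nu> u = u - (2 * (u \<bullet> \<nu>) / (\<nu> \<bullet> \<nu>)) *\<^sub>R \<nu>"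

text \<open>Angle of incidence equals angle of reflection: the incoming ray (pointing along \<open>- u\<close>) and
  the outgoing one make the same angle with the normal, and are coplanar with it.\<close>

lemma reflect_along_angle:
  assumes "\<nu> \<noteq> 0"
  shows "norm (reflect_along \<nu> u) = norm u"
    and "reflect_along \<nu> u \<bullet> \<nu> = (- u) \<bullet> \<nu>"
    and "\<exists>c. reflect_along \<nu> u = u + c *\<^sub>R \<nu>"
proof -
  have nz: "\<nu> \<bullet> \<nu> \<noteq> 0" using assms by simp
  then show "reflect_along \<nu> u \<bullet> \<nu> = (- u) \<bullet> \<nu>"
    by (simp add: reflect_along_def inner_diff_left)
  have "reflect_along \<nu> u \<bullet> reflect_along \<nu> u = u \<bullet> u"
    using nz by (simp add: reflect_along_def inner_diff_left inner_diff_right inner_commute field_simps)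
  then show "norm (reflect_along \<nu> u) = norm u"
    by (simp add: norm_eq_sqrt_inner)
  show "\<exists>c. reflect_along \<nu> u = u + c *\<^sub>R \<nu>"
    by (rule exI[of _ "- (2 * (u \<bullet> \<nu>) / (\<nu> \<bullet> \<nu>))"]) (simp add: reflect_along_def)
qed

definition oriented_line :: "(real \<Rightarrow> 'a::euclidean_space) \<Rightarrow> bool" where
  "oriented_line \<gamma> \<longleftrightarrow> (\<exists>p v. norm v = 1 \<and> \<gamma> = (\<lambda>t. p + t *\<^sub>R v))"

definition euclidean_billiard ::
  "'a::euclidean_space set \<Rightarrow> (real \<Rightarrow> 'a) \<Rightarrow> (real \<Rightarrow> 'a) \<Rightarrow> bool" where
  "euclidean_billiard S \<gamma> \<delta> \<longleftrightarrow>
     oriented_line \<gamma> \<and> oriented_line \<delta> \<and>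
     (\<exists>s t \<nu>. \<gamma> s \<in> S \<and> (\<forall>r>s. \<gamma> r \<notin> S) \<and> \<delta> t = \<gamma> s \<and>
        \<nu> \<noteq> 0 \<and> (\<forall>h\<in>tangent_space S (\<gamma> s). \<nu> \<bullet> h = 0) \<and>
        vector_derivative \<delta> (at t) = reflect_along \<nu> (vector_derivative \<gamma> (at s)))"

definition euclidean_billiard_orbit ::
  "'a::euclidean_space set \<Rightarrow> (nat \<Rightarrow> real \<Rightarrow> 'a) \<Rightarrow> bool" where
  "euclidean_billiard_orbit S g \<longleftrightarrow> (\<forall>k. euclidean_billiard S (g k) (g (Suc k)))"


section \<open>Ellipsoids and affine transformations\<close>

definition ellipsoid :: "(real ^ 'n) set \<Rightarrow> bool" where
  "ellipsoid E \<longleftrightarrow>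
     (\<exists>(Q :: real ^ 'n ^ 'n) c. transpose Q = Q \<and> (\<forall>x. x \<noteq> 0 \<longrightarrow> x \<bullet> (Q *v x) > 0) \<and>
        E = {x. (x - c) \<bullet> (Q *v (x - c)) = 1})"

definition affine_transformation :: "('a::euclidean_space \<Rightarrow> 'a) \<Rightarrow> bool" where
  "affine_transformation A \<longleftrightarrow> (\<exists>T b. linear T \<and> bij T \<and> A = (\<lambda>x. T x + b))"

definition sends_structure ::
  "('a::euclidean_space \<Rightarrow> 'a) \<Rightarrow> ('a \<Rightarrow> 'a set) \<Rightarrow> ('a \<Rightarrow> 'a set) \<Rightarrow> bool" where
  "sends_structure A I J \<longleftrightarrow> (\<forall>x. frechet_derivative A (at x) ` I x = J (A x))"

end

theory Submission
  imports Defs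
begin

text \<open>Let \<open>J\<close> be the indicatrix, \<open>F\<close> its norm and \<open>D u\<close> the Legendre transform of \<open>u \<in> J\<close>, which is the
  unique subgradient of \<open>F\<close> at \<open>u\<close>. Projectivity provides for each hyperplane \<open>H\<close> a linear involution
  \<open>\<sigma>\<close> such that the differentials of \<open>F\<close> and of \<open>F \<circ> \<sigma>\<close> agree along \<open>H\<close>; hence \<open>F \<circ> \<sigma> - F\<close> is
  constant on the translates of \<open>H\<close>, and it vanishes on the line \<open>N\<close>, so \<open>\<sigma>\<close> is an isometry of \<open>F\<close>.
  The Finsler reflection with respect to \<open>H = ker (D u - D v)\<close> maps \<open>u\<close> to \<open>v\<close>, so every two
  points of \<open>J\<close> are swapped by a linear isometry, which gives \<open>D u v = D v u\<close>. Therefore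
  \<open>(r u, s v) \<mapsto> r s D u v\<close> is a symmetric bilinear form, and its unit sphere is \<open>J\<close>.\<close>

section \<open>Hypersurfaces and linear isomorphisms\<close>

text \<open>Since \<open>U\<close> is open, \<open>f\<close> and \<open>g\<close> agree near each of
  its points, so their derivatives agree on \<open>U\<close> as well and the induction goes
  on.\<close>

lemma Ck_on_cong:
  assumes "open U" "\<And>x. x \<in> U \<Longrightarrow> f x = g x" "Ck_on k f U"
  shows "Ck_on k g U"
  using assms(2,3)
proof (induction k arbitrary: f g)
  case 0
  then show ?case by (simp cong: continuous_on_cong)
next
  case (Suc k)
  have der: "(g has_derivative frechet_derivative f (at x)) (at x)" if "x \<in> U" for x
  proof -
    have "(f has_derivative frechet_derivative f (at x)) (at x)"
      using Suc.prems(2) that frechet_derivative_works by auto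
    from has_derivative_transform_within_open[OF this assms(1) that] show ?thesis
      using Suc.prems(1) by blast
  qed
  have eq: "frechet_derivative g (at x) = frechet_derivative f (at x)" if "x \<in> U" for x
    using frechet_derivative_at[OF der[OF that]] by simp
  have "Ck_on k (\<lambda>x. frechet_derivative g (at x) v) U" for v
    using Suc.IH[of "\<lambda>x. frechet_derivative f (at x) v" "\<lambda>x. frechet_derivative g (at x) v"]
      Suc.prems(2) eq by simp
  moreover have "g differentiable (at x)" if "x \<in> U" for x
    using der[OF that] differentiable_def by blast
  ultimately show ?case by simp
qed

lemma frechet_derivative_compose_linear:
  assumes "bounded_linear L" "f differentiable (at (L x))"
  shows "((\<lambda>x. f (L x)) has_derivative (\<lambda>v. frechet_derivative f (at (L x)) (L v))) (at x)"
  using has_derivative_compose[OF bounded_linear_imp_has_derivative[OF assms(1)]]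
    assms(2) frechet_derivative_works by blast

text \<open>The derivative of \<open>f \<circ> L\<close> in direction \<open>v\<close> is the
  derivative of \<open>f\<close> in the fixed direction \<open>L v\<close>, composed with
  \<open>L\<close>: the same shape, one order lower.\<close>

lemma Ck_on_compose_linear:
  assumes "bounded_linear L" "open U" "Ck_on k f U"
  shows "Ck_on k (\<lambda>x. f (L x)) (L -` U)"
  using assms(3)
proof (induction k arbitrary: f)
  case 0
  have "continuous_on (L -` U) L"
    using assms(1) linear_continuous_on by blast
  then show ?case
    using 0 continuous_on_compose2[of U f "L -` U" L] by auto
next
  case (Suc k)
  have opn: "open (L -` U)"
    using assms continuous_open_vimage linear_continuous_on by (metis open_vimage)
  have der: "((\<lambda>x. f (L x)) has_derivative (\<lambda>v. frechet_derivative f (at (L x)) (L v))) (at x)"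
    if "x \<in> L -` U" for x
    using that Suc.prems by (intro frechet_derivative_compose_linear assms) auto
  have "Ck_on k (\<lambda>x. frechet_derivative (\<lambda>x. f (L x)) (at x) v) (L -` U)" for v
  proof (rule Ck_on_cong[OF opn])
    show "Ck_on k (\<lambda>x. frechet_derivative f (at (L x)) (L v)) (L -` U)"
      using Suc.IH[of "\<lambda>y. frechet_derivative f (at y) (L v)"] Suc.prems by simp
    show "frechet_derivative f (at (L x)) (L v) = frechet_derivative (\<lambda>x. f (L x)) (at x) v"
      if "x \<in> L -` U" for x
      using frechet_derivative_at[OF der[OF that]] by metis
  qed
  moreover have "(\<lambda>x. f (L x)) differentiable (at x)" if "x \<in> L -` U" for x
    using der[OF that] differentiable_def by blast
  ultimately show ?case by simp
qed

lemma linear_bij_inverse: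
  fixes T :: "'a::euclidean_space \<Rightarrow> 'a"
  assumes "linear T" "bij T"
  obtains L where "linear L" "\<And>x. L (T x) = x" "\<And>x. T (L x) = x"
  using linear_injective_isomorphism[OF assms(1) bij_is_inj[OF assms(2)]] by blast

text \<open>A local equation \<open>f\<close> of \<open>S\<close> becomes \<open>f \<circ> L\<close>
  for the inverse \<open>L\<close>; its derivative is nonzero because \<open>L\<close> is
  onto.\<close>

lemma smooth_hypersurface_linear_image:
  fixes T :: "'a::euclidean_space \<Rightarrow> 'a"
  assumes T: "linear T" "bij T" and S: "smooth_hypersurface S"
  shows "smooth_hypersurface (T ` S)"
  unfolding smooth_hypersurface_def
proof
  fix p assume "p \<in> T ` S"
  obtain L where L: "linear L" "\<And>x. L (T x) = x" "\<And>x. T (L x) = x"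
    using linear_bij_inverse[OF T] by metis
  have bl: "bounded_linear L" using L(1) linear_conv_bounded_linear by blast
  have "L p \<in> S" using \<open>p \<in> T ` S\<close> L by auto
  then obtain U and f :: "'a \<Rightarrow> real" where U: "open U" "L p \<in> U" "smooth_on f U"
    "\<forall>x\<in>U. frechet_derivative f (at x) \<noteq> (\<lambda>_. 0)" "S \<inter> U = {x\<in>U. f x = 0}"
    using S unfolding smooth_hypersurface_def by blast
  let ?U = "L -` U" and ?f = "\<lambda>x. f (L x)"
  have "open ?U" using U(1) bl linear_continuous_on by (metis open_vimage)
  moreover have "smooth_on ?f ?U"
    using Ck_on_compose_linear[OF bl U(1)] U(3) unfolding smooth_on_def by blast
  moreover have "\<forall>x\<in>?U. frechet_derivative ?f (at x) \<noteq> (\<lambda>_. 0)"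
  proof
    fix x assume x: "x \<in> ?U"
    have "Ck_on (Suc 0) f U" using U(3) unfolding smooth_on_def by blast
    then have "f differentiable (at (L x))" using x by auto
    then have eq: "frechet_derivative ?f (at x) = (\<lambda>v. frechet_derivative f (at (L x)) (L v))"
      using frechet_derivative_at[OF frechet_derivative_compose_linear[OF bl]] by metis
    obtain v where "frechet_derivative f (at (L x)) v \<noteq> 0" using U(4) x by fastforce
    then have "frechet_derivative ?f (at x) (T v) \<noteq> 0" using eq L by simp
    then show "frechet_derivative ?f (at x) \<noteq> (\<lambda>_. 0)" by metis
  qed
  moreover have "T ` S \<inter> ?U = {x\<in>?U. ?f x = 0}"
  proof -
    have "x \<in> T ` S \<longleftrightarrow> L x \<in> S" for x using L by (metis imageE imageI)
    then show ?thesis using U(5) by blast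
  qed
  ultimately show "\<exists>U (f :: 'a \<Rightarrow> real). open U \<and> p \<in> U \<and> smooth_on f U \<and>
        (\<forall>x\<in>U. frechet_derivative f (at x) \<noteq> (\<lambda>_. 0)) \<and> T ` S \<inter> U = {x\<in>U. f x = 0}"
    using U(2) by (intro exI[of _ ?U] exI[of _ ?f]) auto
qed

text \<open>\<open>T\<close> commutes with interior, frontier and open segments, so the image of
  \<open>K\<close> is the required body.\<close>

lemma strictly_convex_closed_hypersurface_linear_image:
  fixes T :: "'a::euclidean_space \<Rightarrow> 'a"
  assumes T: "linear T" "bij T" and S: "strictly_convex_closed_hypersurface S"
  shows "strictly_convex_closed_hypersurface (T ` S)"
proof -
  obtain K where K: "compact K" "interior K \<noteq> {}"
    "\<forall>x\<in>K. \<forall>y\<in>K. x \<noteq> y \<longrightarrow> open_segment x y \<subseteq> interior K" "S = frontier K"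
    using S unfolding strictly_convex_closed_hypersurface_def by blast
  have inj: "inj T" using T bij_is_inj by blast
  have int: "interior (T ` K) = T ` interior K"
    using interior_injective_linear_image[OF T(1) inj] .
  have "frontier (T ` K) = T ` frontier K"
    unfolding frontier_def int closure_injective_linear_image[OF T(1) inj, symmetric]
    by (simp add: image_set_diff inj)
  then have front: "T ` S = frontier (T ` K)" using K(4) by simp
  have comp: "compact (T ` K)" using K(1) T(1) compact_continuous_image linear_continuous_on
    linear_conv_bounded_linear by blast
  have strict: "\<forall>x\<in>T ` K. \<forall>y\<in>T ` K. x \<noteq> y \<longrightarrow> open_segment x y \<subseteq> interior (T ` K)"
    unfolding int
  proof (intro ballI impI)
    fix x y assume xy: "x \<in> T ` K" "y \<in> T ` K" "x \<noteq> y"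
    then obtain a b where ab: "a \<in> K" "b \<in> K" "x = T a" "y = T b" by blast
    then have "open_segment a b \<subseteq> interior K" using K(3) xy(3) by metis
    then show "open_segment x y \<subseteq> T ` interior K"
      unfolding ab(3,4) open_segment_linear_image[OF T(1) inj] by (rule image_mono)
  qed
  have "smooth_hypersurface S"
    using S unfolding strictly_convex_closed_hypersurface_def by blast
  from smooth_hypersurface_linear_image[OF T this] show ?thesis
    unfolding strictly_convex_closed_hypersurface_def
    using front comp strict K(2) int by (intro conjI exI[of _ "T ` K"]) auto
qed

lemma tangent_space_linear_image:
  fixes T :: "'a::euclidean_space \<Rightarrow> 'a"
  assumes T: "linear T" "bij T"
  shows "tangent_space (T ` S) (T q) = T ` tangent_space S q"
proof -
  \<comment> \<open>Proved for any linear map, so that it can be applied to \<open>T\<close> and to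
    its inverse.\<close>
  have sub: "A ` tangent_space S q \<subseteq> tangent_space (A ` S) (A q)" if "linear A"
    for A :: "'a \<Rightarrow> 'a" and S q
  proof
    fix w assume "w \<in> A ` tangent_space S q"
    then obtain \<gamma> v where g: "w = A v" "\<gamma> 0 = q" "\<forall>t. \<gamma> t \<in> S" "(\<gamma> has_vector_derivative v) (at 0)"
      unfolding tangent_space_def by blast
    have "((\<lambda>t. A (\<gamma> t)) has_vector_derivative A v) (at 0)"
      using bounded_linear.has_vector_derivative[OF _ g(4), of A] that linear_conv_bounded_linear by blast
    then show "w \<in> tangent_space (A ` S) (A q)"
      unfolding tangent_space_def using g by (auto intro!: exI[of _ "\<lambda>t. A (\<gamma> t)"])
  qed
  obtain L where L: "linear L" "\<And>x. L (T x) = x" "\<And>x. T (L x) = x"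
    using linear_bij_inverse[OF T] by metis
  have "L ` T ` S = S" using L(2) by (simp add: image_image)
  then have "L ` tangent_space (T ` S) (T q) \<subseteq> tangent_space S q"
    using sub[OF L(1), of "T ` S" "T q"] L by simp
  then have "tangent_space (T ` S) (T q) \<subseteq> T ` tangent_space S q"
    using L(3) by (metis image_eqI image_subset_iff subsetI)
  then show ?thesis using sub[OF T(1)] by blast
qed


section \<open>Tangent spaces\<close>

text \<open>The converse inclusion is a pointwise implicit function theorem: the correction \<open>s\<close> transversal
  to the hypersurface is chosen nearly minimal, so that the intermediate value theorem
  gives \<open>s = o(t)\<close> without any continuity of the derivative.\<close>

lemma tangent_space_eq_kernel:
  fixes S :: "'a::euclidean_space set"
  assumes "smooth_hypersurface S" "q \<in> S"
  obtains \<phi> :: "'a \<Rightarrow> real" where "linear \<phi>" "\<phi> \<noteq> (\<lambda>_. 0)" "tangent_space S q = {h. \<phi> h = 0}"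
proof -
  obtain U and f :: "'a \<Rightarrow> real" where U: "open U" "q \<in> U" "smooth_on f U"
    "\<forall>x\<in>U. frechet_derivative f (at x) \<noteq> (\<lambda>_. 0)" "S \<inter> U = {x\<in>U. f x = 0}"
    using assms unfolding smooth_hypersurface_def by blast
  have ck: "Ck_on (Suc 0) f U" using U(3) unfolding smooth_on_def by blast
  have diff: "f differentiable (at x)" if "x \<in> U" for x using ck that by simp
  have contf: "isCont f x" if "x \<in> U" for x
    using diff[OF that] differentiable_imp_continuous_within by blast
  define \<phi> where "\<phi> = frechet_derivative f (at q)"
  have der: "(f has_derivative \<phi>) (at q)"
    using diff[OF U(2)] frechet_derivative_works unfolding \<phi>_def by blast
  have lin: "linear \<phi>" using der has_derivative_linear by blast
  have nz: "\<phi> \<noteq> (\<lambda>_. 0)" using U unfolding \<phi>_def by blast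
  have "f q = 0" using U assms(2) by blast
  have sub: "\<phi> v = 0" if "v \<in> tangent_space S q" for v
  proof -
    obtain \<gamma> where g: "\<gamma> 0 = q" "\<forall>t. \<gamma> t \<in> S" "(\<gamma> has_vector_derivative v) (at 0)"
      using \<open>v \<in> tangent_space S q\<close> unfolding tangent_space_def by blast
    have gd: "(\<gamma> has_derivative (\<lambda>x. x *\<^sub>R v)) (at 0)"
      using g(3) unfolding has_vector_derivative_def .
    have "((\<lambda>t. f (\<gamma> t)) has_derivative (\<lambda>x. \<phi> (x *\<^sub>R v))) (at 0)"
      using has_derivative_compose[OF gd, of f \<phi>] der g(1) by simp
    moreover have "eventually (\<lambda>t. f (\<gamma> t) = 0) (at 0)"
    proof -
      have "isCont \<gamma> 0" using gd has_derivative_continuous by blast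
      then have "eventually (\<lambda>t. \<gamma> t \<in> U) (at 0)"
        using U(1,2) g(1) by (simp add: isCont_def topological_tendstoD)
      then show ?thesis by eventually_elim (use U(5) g(2) in blast)
    qed
    then have "\<forall>\<^sub>F t in at 0. 0 = f (\<gamma> t)" by (rule eventually_mono) simp
    then have "((\<lambda>t. f (\<gamma> t)) has_derivative (\<lambda>x. 0)) (at 0)"
      using g(1) \<open>f q = 0\<close>
      by (intro has_derivative_transform_eventually[OF has_derivative_const]) auto
    ultimately have "(\<lambda>x. \<phi> (x *\<^sub>R v)) = (\<lambda>x. 0)" using has_derivative_unique by blast
    from fun_cong[OF this, of 1] show ?thesis by simp
  qed
  have sup: "v \<in> tangent_space S q" if v: "\<phi> v = 0" for v
  proof -
    obtain m where "\<phi> m \<noteq> 0" using nz by blast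
    define n where "n = (1 / \<phi> m) *\<^sub>R m"
    have n: "\<phi> n = 1" using lin \<open>\<phi> m \<noteq> 0\<close> by (simp add: n_def linear_scale)
    \<comment> \<open>For \<open>|s| \<le> e * |t|\<close> the point moves by at most
      \<open>c * |t|\<close>. Accuracy \<open>e / (2 * c)\<close> then keeps \<open>f\<close> within
      \<open>e * |t| / 2\<close> of \<open>s\<close>, so \<open>f\<close> is \<le> 0 at the lower
      and \<ge> 0 at the upper extreme of \<open>s\<close>.\<close>
    have zeros: "\<exists>d>0. \<forall>t. \<bar>t\<bar> < d \<longrightarrow> (\<exists>s. \<bar>s\<bar> \<le> e * \<bar>t\<bar> \<and> q + t *\<^sub>R v + s *\<^sub>R n \<in> S)"
      if e: "e > 0" for e
    proof -
      define c where "c = norm v + e * norm n + 1"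
      have c: "c > 0" using e unfolding c_def by (smt (verit) mult_nonneg_nonneg norm_ge_zero)
      obtain r where r: "r > 0" "ball q r \<subseteq> U" using U(1,2) open_contains_ball by blast
      obtain d0 where d0: "d0 > 0"
        "\<And>y. norm (y - q) < d0 \<Longrightarrow> \<bar>f y - f q - \<phi> (y - q)\<bar> \<le> e / (2 * c) * norm (y - q)"
        using der e c unfolding has_derivative_at_alt
        by (metis divide_pos_pos mult_pos_pos zero_less_numeral real_norm_def)
      define d where "d = min r d0 / c"
      have "\<exists>s. \<bar>s\<bar> \<le> e * \<bar>t\<bar> \<and> q + t *\<^sub>R v + s *\<^sub>R n \<in> S" if t: "\<bar>t\<bar> < d" for t
      proof -
        let ?p = "\<lambda>s. q + t *\<^sub>R v + s *\<^sub>R n"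
        have nrm: "norm (?p s - q) \<le> c * \<bar>t\<bar>" if "\<bar>s\<bar> \<le> e * \<bar>t\<bar>" for s
        proof -
          have "norm (?p s - q) \<le> \<bar>t\<bar> * norm v + \<bar>s\<bar> * norm n"
            by (smt (verit, ccfv_threshold) add_diff_cancel_left' add.assoc norm_scaleR norm_triangle_ineq)
          also have "\<dots> \<le> \<bar>t\<bar> * norm v + e * \<bar>t\<bar> * norm n"
            using that by (simp add: mult_right_mono)
          also have "\<dots> \<le> c * \<bar>t\<bar>" unfolding c_def by (simp add: algebra_simps)
          finally show ?thesis .
        qed
        have ct: "c * \<bar>t\<bar> < min r d0"
          using t c unfolding d_def by (simp add: field_simps)
        have inU: "?p s \<in> U" if "\<bar>s\<bar> \<le> e * \<bar>t\<bar>" for s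
        proof -
          have "norm (?p s - q) < r" using nrm[OF that] ct by linarith
          then have "dist q (?p s) < r" by (simp only: dist_norm norm_minus_commute)
          then show ?thesis using r(2) by auto
        qed
        have est: "\<bar>f (?p s) - s\<bar> \<le> (e * \<bar>t\<bar>) / 2" if s: "\<bar>s\<bar> \<le> e * \<bar>t\<bar>" for s
        proof -
          have "\<phi> (?p s - q) = s"
            using lin v n by (simp add: add.assoc linear_add linear_scale)
          then have "\<bar>f (?p s) - s\<bar> \<le> e / (2 * c) * norm (?p s - q)"
            using d0(2)[of "?p s"] nrm[OF s] ct \<open>f q = 0\<close> by auto
          also have "\<dots> \<le> e / (2 * c) * (c * \<bar>t\<bar>)"
            using nrm[OF s] e c by (intro mult_left_mono) auto
          also have "\<dots> = (e * \<bar>t\<bar>) / 2" using c by (simp add: field_simps)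
          finally show ?thesis .
        qed
        have et: "0 \<le> e * \<bar>t\<bar>" using e by simp
        have "\<exists>s\<ge>- (e * \<bar>t\<bar>). s \<le> e * \<bar>t\<bar> \<and> f (?p s) = 0"
        proof (rule IVT)
          show "f (?p (- (e * \<bar>t\<bar>))) \<le> 0" using est[of "- (e * \<bar>t\<bar>)"] et by linarith
          show "0 \<le> f (?p (e * \<bar>t\<bar>))" using est[of "e * \<bar>t\<bar>"] et by linarith
          show "\<forall>s. - (e * \<bar>t\<bar>) \<le> s \<and> s \<le> e * \<bar>t\<bar> \<longrightarrow> isCont (\<lambda>s. f (?p s)) s"
          proof (intro allI impI)
            fix s assume "- (e * \<bar>t\<bar>) \<le> s \<and> s \<le> e * \<bar>t\<bar>"
            then have "?p s \<in> U" using inU[of s] by auto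
            then show "isCont (\<lambda>s. f (?p s)) s"
              by (intro isCont_o2[OF _ contf]) (auto intro!: continuous_intros)
          qed
        qed (use et in auto)
        then obtain s where s: "\<bar>s\<bar> \<le> e * \<bar>t\<bar>" "f (?p s) = 0"
          by (metis abs_le_iff minus_le_iff)
        then have "?p s \<in> S" using inU[OF s(1)] U(5) by blast
        then show ?thesis using s(1) by blast
      qed
      moreover have "d > 0" unfolding d_def using r d0 c by simp
      ultimately show ?thesis by blast
    qed
    define Z where "Z t = {s. q + t *\<^sub>R v + s *\<^sub>R n \<in> S}" for t :: real
    \<comment> \<open>The infimum of \<open>|s|\<close> over \<open>Z t\<close> is approached up to
      \<open>t\<^sup>2\<close>, an error of order o(t). At \<open>t = 0\<close> this slack is zero,
      but there \<open>s = 0\<close> itself is admissible because \<open>q \<in> S\<close>.\<close>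
    have "\<exists>s. (Z t \<noteq> {} \<longrightarrow> s \<in> Z t) \<and> (\<forall>s'\<in>Z t. \<bar>s\<bar> \<le> \<bar>s'\<bar> + t\<^sup>2) \<and> (t = 0 \<longrightarrow> s = 0)" for t
    proof (cases "t = 0 \<or> Z t = {}")
      case True
      then show ?thesis using assms(2) by (auto simp: Z_def intro!: exI[of _ 0])
    next
      case False
      have bdd: "bdd_below (abs ` Z t)" by (rule bdd_belowI[of _ 0]) auto
      have "Inf (abs ` Z t) < Inf (abs ` Z t) + t\<^sup>2" using False by simp
      then obtain s where "s \<in> Z t" "\<bar>s\<bar> < Inf (abs ` Z t) + t\<^sup>2"
        using False cInf_less_iff[OF _ bdd] by blast
      moreover have "Inf (abs ` Z t) \<le> \<bar>s'\<bar>" if "s' \<in> Z t" for s'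
        using that bdd by (intro cInf_lower) auto
      ultimately show ?thesis using False by (intro exI[of _ s]) force
    qed
    then obtain s where s: "\<And>t. Z t \<noteq> {} \<Longrightarrow> s t \<in> Z t"
      "\<And>t s'. s' \<in> Z t \<Longrightarrow> \<bar>s t\<bar> \<le> \<bar>s'\<bar> + t\<^sup>2" "s 0 = 0" by metis
    \<comment> \<open>The value \<open>q\<close> is a filler keeping the curve in \<open>S\<close>
      at all times; by \<open>zeros\<close>, \<open>Z t\<close> is nonempty for small
      \<open>t\<close>.\<close>
    define \<gamma> where "\<gamma> t = (if Z t = {} then q else q + t *\<^sub>R v + s t *\<^sub>R n)" for t
    have "\<gamma> 0 = q" using s(3) by (simp add: \<gamma>_def)
    moreover have "\<forall>t. \<gamma> t \<in> S" using s(1) assms(2) by (auto simp: \<gamma>_def Z_def)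
    moreover have "(\<gamma> has_vector_derivative v) (at 0)"
      unfolding has_vector_derivative_def has_derivative_at_alt
    proof (intro conjI allI impI)
      show "bounded_linear (\<lambda>x. x *\<^sub>R v)" by (rule bounded_linear_scaleR_left)
      fix e :: real assume e: "0 < e"
      \<comment> \<open>Once \<open>|y| \<le> e'\<close>, the slack \<open>y\<^sup>2\<close> is at
        most \<open>e' * |y|\<close>, so \<open>|s y| \<le> 2 * e' * |y|\<close>; hence the factor
        2.\<close>
      define e' where "e' = e / (2 * (norm n + 1))"
      have n1: "norm n + 1 > 0" by (smt (verit) norm_ge_zero)
      then have e': "e' > 0" using e by (simp add: e'_def)
      obtain d where d: "d > 0"
        "\<And>t. \<bar>t\<bar> < d \<Longrightarrow> \<exists>s. \<bar>s\<bar> \<le> e' * \<bar>t\<bar> \<and> q + t *\<^sub>R v + s *\<^sub>R n \<in> S"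
        using zeros[OF e'] by blast
      have "norm (\<gamma> y - \<gamma> 0 - (y - 0) *\<^sub>R v) \<le> e * norm (y - 0)" if "norm (y - 0) < min d e'" for y
      proof -
        have y: "\<bar>y\<bar> < d" "\<bar>y\<bar> \<le> e'" using that by auto
        obtain s' where s': "\<bar>s'\<bar> \<le> e' * \<bar>y\<bar>" "s' \<in> Z y" using d(2)[OF y(1)] by (auto simp: Z_def)
        then have eq: "\<gamma> y - \<gamma> 0 - (y - 0) *\<^sub>R v = s y *\<^sub>R n" using s(3) by (auto simp: \<gamma>_def)
        have "\<bar>s y\<bar> \<le> e' * \<bar>y\<bar> + y\<^sup>2" using s(2)[OF s'(2)] s'(1) by linarith
        also have "y\<^sup>2 = \<bar>y\<bar> * \<bar>y\<bar>" by (simp add: power2_eq_square)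
        also have "e' * \<bar>y\<bar> + \<bar>y\<bar> * \<bar>y\<bar> \<le> e' * \<bar>y\<bar> + e' * \<bar>y\<bar>"
          using y(2) by (intro add_left_mono mult_right_mono) auto
        finally have "\<bar>s y\<bar> * norm n \<le> (2 * e' * \<bar>y\<bar>) * (norm n + 1)"
          using e' by (intro mult_mono) auto
        also have "\<dots> = e * \<bar>y\<bar>" using n1 by (simp add: e'_def field_simps)
        finally show ?thesis unfolding eq by simp
      qed
      then show "\<exists>d>0. \<forall>y. norm (y - 0) < d \<longrightarrow> norm (\<gamma> y - \<gamma> 0 - (y - 0) *\<^sub>R v) \<le> e * norm (y - 0)"
        using d(1) e' by (intro exI[of _ "min d e'"]) auto
    qed
    ultimately show ?thesis unfolding tangent_space_def by blast
  qed
  have "tangent_space S q = {h. \<phi> h = 0}" using sub sup by blast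
  then show thesis using that lin nz by blast
qed

text \<open>\<open>adjoint \<phi> 1\<close> is the Riesz vector of \<open>\<phi>\<close>, so the
  kernel is its orthogonal complement.\<close>

lemma kernel_hyperplane:
  fixes \<phi> :: "'a::euclidean_space \<Rightarrow> real"
  assumes "linear \<phi>" "\<phi> \<noteq> (\<lambda>_. 0)"
  shows "subspace {h. \<phi> h = 0}" "dim {h. \<phi> h = 0} + 1 = DIM('a)"
proof -
  have "\<phi> = (\<lambda>h. adjoint \<phi> 1 \<bullet> h)"
  proof
    show "\<phi> h = adjoint \<phi> 1 \<bullet> h" for h
      using adjoint_works[OF assms(1), of h 1] by (simp add: inner_commute)
  qed
  then obtain a where eq: "\<phi> = (\<lambda>h. a \<bullet> h)" by blast
  then have "a \<noteq> 0" using assms(2) by auto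
  then have "dim {h. a \<bullet> h = 0} = DIM('a) - 1" by (rule dim_hyperplane)
  moreover have "DIM('a) > 0" by simp
  ultimately show "dim {h. \<phi> h = 0} + 1 = DIM('a)" unfolding eq by linarith
  show "subspace {h. \<phi> h = 0}" unfolding eq by (rule subspace_hyperplane)
qed

lemma hyperplane_kernel:
  fixes H :: "'a::euclidean_space set"
  assumes "subspace H" "dim H + 1 = DIM('a)"
  obtains \<xi> :: "'a \<Rightarrow> real" where "linear \<xi>" "H = {h. \<xi> h = 0}"
proof -
  obtain a where a: "a \<noteq> 0" "span H \<subseteq> {x. a \<bullet> x = 0}"
    using lowdim_subset_hyperplane[of H] assms(2) by auto
  have "dim {x. a \<bullet> x = 0} = DIM('a) - 1" using a(1) by (rule dim_hyperplane)
  then have "H = {x. a \<bullet> x = 0}"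
    using a(2) assms span_superset[of H]
    by (intro subspace_dim_equal subspace_hyperplane) auto
  then show thesis using that[of "\<lambda>x. a \<bullet> x"] by (simp add: linear_iff inner_add_right)
qed

text \<open>\<open>x - w x *\<^sub>R u\<close> lies in the kernel of \<open>w\<close>. This gives
  the uniqueness of the covector described in \<open>legendre\<close>.\<close>

lemma linear_functional_determined:
  fixes w w' :: "'a::real_vector \<Rightarrow> real"
  assumes "linear w" "linear w'" "w u = 1" "w' u = 1" "\<And>h. w h = 0 \<Longrightarrow> w' h = 0"
  shows "w = w'"
proof
  fix x
  have "w (x - w x *\<^sub>R u) = 0" using assms by (simp add: linear_diff linear_scale)
  then have "w' (x - w x *\<^sub>R u) = 0" using assms(5) by blast
  then show "w x = w' x" using assms by (simp add: linear_diff linear_scale)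
qed


section \<open>Legendre transform and Finsler reflection\<close>

locale symmetric_indicatrix =
  fixes J :: "'a::euclidean_space set"
  assumes hypersurface: "strictly_convex_closed_hypersurface J"
    and symmetric: "uminus ` J = J"
begin

abbreviation D :: "'a \<Rightarrow> 'a \<Rightarrow> real" where "D \<equiv> legendre J"

section \<open>The convex body bounded by the indicatrix\<close>

lemma minus_mem: "x \<in> J \<Longrightarrow> - x \<in> J"
  using symmetric by blast

text \<open>By Krein-Milman the unnamed body \<open>K\<close> with frontier \<open>J\<close> is the
  convex hull of \<open>J\<close>. It is symmetric, so 0 is interior as the midpoint of interior
  points \<open>x\<close> and \<open>- x\<close>.\<close>

lemma convex_body:
  shows "compact (convex hull J)" "frontier (convex hull J) = J" "0 \<in> interior (convex hull J)"
    and "\<And>x y. x \<in> convex hull J \<Longrightarrow> y \<in> convex hull J \<Longrightarrow> x \<noteq> y \<Longrightarrow>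
           open_segment x y \<subseteq> interior (convex hull J)"
proof -
  obtain K where K: "compact K" "interior K \<noteq> {}"
    "\<forall>x\<in>K. \<forall>y\<in>K. x \<noteq> y \<longrightarrow> open_segment x y \<subseteq> interior K" "J = frontier K"
    using hypersurface unfolding strictly_convex_closed_hypersurface_def by blast
  have "convex K"
    unfolding convex_contains_open_segment using K(3) interior_subset
    by (metis empty_subsetI open_segment_idem subset_trans)
  then have hull: "convex hull J = K" using Krein_Milman_frontier K(1,4) by metis
  have lin: "linear (uminus :: 'a \<Rightarrow> 'a)" by (simp add: linear_iff)
  have "uminus ` K = K"
    using convex_hull_linear_image[OF lin, of J] symmetric hull by simp
  then have int: "uminus ` interior K = interior K"
    using interior_injective_linear_image[OF lin, of K] by simp
  obtain x where x: "x \<in> interior K" using K(2) by blast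
  then have "- x \<in> interior K" using int by blast
  then have "(1/2) *\<^sub>R x + (1/2) *\<^sub>R (- x) \<in> interior K"
    by (intro convexD[OF convex_interior[OF \<open>convex K\<close>] x]) auto
  then have "0 \<in> interior K" by simp
  then show "compact (convex hull J)" "frontier (convex hull J) = J" "0 \<in> interior (convex hull J)"
    "\<And>x y. x \<in> convex hull J \<Longrightarrow> y \<in> convex hull J \<Longrightarrow> x \<noteq> y \<Longrightarrow>
           open_segment x y \<subseteq> interior (convex hull J)"
    using K hull by auto
qed

lemma compact_J: "compact J"
  using compact_frontier[OF convex_body(1)] convex_body(2) by simp

lemma zero_notin: "0 \<notin> J"
  using convex_body(2,3) by (auto simp: frontier_def)

lemma ray_meets:
  assumes "x \<noteq> 0"
  obtains r u where "r > 0" "u \<in> J" "x = r *\<^sub>R u"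
proof -
  obtain d where d: "0 < d" "0 + d *\<^sub>R x \<in> frontier (convex hull J)"
    using ray_to_frontier[OF _ convex_body(3) assms] compact_imp_bounded[OF convex_body(1)] by blast
  then show thesis
    using that[of "1 / d" "d *\<^sub>R x"] convex_body(2) by simp
qed

lemma nonempty: "J \<noteq> {}"
proof -
  obtain b :: 'a where "b \<in> Basis" by fastforce
  then show ?thesis using ray_meets[of b] nonzero_Basis by blast
qed

section \<open>Supporting functionals\<close>

lemma functional_le_hull:
  assumes "linear w" "\<And>x. x \<in> J \<Longrightarrow> w x \<le> (1::real)" "x \<in> convex hull J"
  shows "w x \<le> 1"
proof -
  have "convex {x. w x \<le> 1}"
    unfolding convex_def using assms(1)
    by (auto simp: linear_add linear_scale) (metis add_mono mult_left_le mult.commute)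
  then have "convex hull J \<subseteq> {x. w x \<le> 1}" using assms(2) by (intro hull_minimal) auto
  then show ?thesis using assms(3) by blast
qed

text \<open>By strict convexity the midpoint of two contact points is interior to the hull; a small
  push along \<open>u\<close> stays in the hull but raises \<open>w\<close> above 1.\<close>

lemma functional_max_unique:
  assumes "linear w" "\<And>x. x \<in> J \<Longrightarrow> w x \<le> (1::real)" "u \<in> J" "v \<in> J" "w u = 1" "w v = 1"
  shows "u = v"
proof (rule ccontr)
  assume ne: "u \<noteq> v"
  have "midpoint u v \<in> interior (convex hull J)"
    using convex_body(4)[OF _ _ ne] assms(3,4) ne hull_inc[of _ J convex] midpoint_in_open_segment by blast
  then obtain e where e: "e > 0" "cball (midpoint u v) e \<subseteq> convex hull J"
    using mem_interior_cball by blast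
  define y where "y = midpoint u v + (e / norm u) *\<^sub>R u"
  have nu: "norm u > 0" using assms(3) zero_notin by auto
  then have "y \<in> cball (midpoint u v) e" using e by (simp add: y_def dist_norm)
  then have "w y \<le> 1" using functional_le_hull[OF assms(1,2)] e(2) by blast
  moreover have "w y = 1 + e / norm u"
    using assms by (simp add: y_def midpoint_def linear_add linear_scale)
  ultimately have "e / norm u \<le> 0" by simp
  then show False using e(1) nu by (simp add: divide_le_0_iff)
qed

text \<open>Along a curve in \<open>J\<close> through \<open>u\<close> the value of \<open>w\<close>
  has a maximum at time 0, so its derivative there is zero.\<close>

lemma support_functional_kills_tangent:
  assumes "linear w" "\<And>x. x \<in> J \<Longrightarrow> w x \<le> (1::real)" "w u = 1" "v \<in> tangent_space J u"
  shows "w v = 0"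
proof -
  obtain \<gamma> where g: "\<gamma> 0 = u" "\<forall>t. \<gamma> t \<in> J" "(\<gamma> has_vector_derivative v) (at 0)"
    using assms(4) unfolding tangent_space_def by blast
  have "((\<lambda>t. w (\<gamma> t)) has_vector_derivative w v) (at 0)"
    using bounded_linear.has_vector_derivative[OF _ g(3), of w] assms(1)
      linear_conv_bounded_linear by blast
  then have "((\<lambda>t. w (\<gamma> t)) has_derivative (\<lambda>x. x *\<^sub>R w v)) (at 0)"
    unfolding has_vector_derivative_def .
  from has_derivative_local_max[OF this] have "(\<lambda>x. x *\<^sub>R w v) = (\<lambda>h. 0)"
    using g assms(2,3) by auto
  from fun_cong[OF this, of 1] show ?thesis by simp
qed

lemma supporting_functional:
  assumes "u \<in> J"
  obtains w where "linear w" "w u = (1::real)" "\<And>x. x \<in> J \<Longrightarrow> w x \<le> 1"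
proof -
  let ?K = "convex hull J"
  have u: "u \<in> frontier ?K" using assms convex_body(2) by simp
  then have "u \<in> ?K" "u \<notin> interior ?K"
    using compact_imp_closed[OF convex_body(1)] by (auto simp: frontier_def)
  then have "u \<in> closure ?K" "u \<notin> rel_interior ?K"
    using convex_body(3) rel_interior_nonempty_interior[of ?K] closure_subset by blast+
  then obtain a where a: "\<And>y. y \<in> closure ?K \<Longrightarrow> a \<bullet> u \<le> a \<bullet> y"
      "\<And>y. y \<in> rel_interior ?K \<Longrightarrow> a \<bullet> u < a \<bullet> y"
    using supporting_hyperplane_relative_frontier[OF convex_convex_hull] by blast
  \<comment> \<open>As 0 is interior, the functional of \<open>a\<close> is strictly larger at 0
    than at \<open>u\<close>. Dividing by the negative number \<open>a \<bullet> u\<close> then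
    turns \<open>a \<bullet> u \<le> a \<bullet> x\<close> into the bound by 1.\<close>
  have "a \<bullet> u < 0"
    using a(2)[of 0] convex_body(3) rel_interior_nonempty_interior[of ?K] by auto
  moreover have "a \<bullet> u \<le> a \<bullet> x" if "x \<in> J" for x
    using a(1) that hull_inc closure_subset by (metis subset_iff)
  ultimately show thesis
    using that[of "\<lambda>x. (a \<bullet> x) / (a \<bullet> u)"]
    by (auto simp: linear_iff inner_add_right add_divide_distrib divide_le_eq)
qed

section \<open>The Legendre transform as supporting covector\<close>

lemma smooth: "smooth_hypersurface J"
  using hypersurface strictly_convex_closed_hypersurface_def by blast

text \<open>The kernel of \<open>\<phi>\<close> is the tangent hyperplane and \<open>w\<close>
  vanishes on it, so \<open>w\<close> is \<open>\<phi>\<close> normalized at \<open>u\<close>. This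
  trades the tangent space in \<open>legendre\<close> for a support inequality.\<close>

lemma legendre_eqI:
  assumes u: "u \<in> J" and w: "linear w" "w u = 1" "\<And>x. x \<in> J \<Longrightarrow> w x \<le> 1"
  shows "D u = w"
proof -
  obtain \<phi> :: "'a \<Rightarrow> real" where \<phi>: "linear \<phi>" "\<phi> \<noteq> (\<lambda>_. 0)" "tangent_space J u = {h. \<phi> h = 0}"
    by (rule tangent_space_eq_kernel[OF smooth u])
  have sub: "w h = 0" if "\<phi> h = 0" for h
    using support_functional_kills_tangent[OF w(1,3,2)] \<phi>(3) that by blast
  have "\<phi> u \<noteq> 0" using sub w(2) by force
  then have "(\<lambda>h. \<phi> h / \<phi> u) = w"
    using \<phi>(1) w sub
    by (intro linear_functional_determined[of _ _ u])
      (auto simp: linear_iff add_divide_distrib)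
  then have ker: "{h. w h = 0} = tangent_space J u"
    using \<phi>(3) \<open>\<phi> u \<noteq> 0\<close> by fastforce
  show ?thesis
    unfolding legendre_def
  proof (rule the_equality)
    show "linear w \<and> w u = 1 \<and> {h. w h = 0} = tangent_space J u" using w ker by blast
    fix w' :: "'a \<Rightarrow> real"
    assume w': "linear w' \<and> w' u = 1 \<and> {h. w' h = 0} = tangent_space J u"
    then show "w' = w"
      using ker w by (intro linear_functional_determined[of _ _ u]) auto
  qed
qed

lemma legendre_supports:
  assumes "u \<in> J"
  shows "linear (D u)" "D u u = 1" "\<And>x. x \<in> J \<Longrightarrow> D u x \<le> 1"
proof -
  obtain w where w: "linear w" "w u = (1::real)" "\<And>x. x \<in> J \<Longrightarrow> w x \<le> 1"
    using supporting_functional[OF assms] by blast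
  then have "D u = w" using legendre_eqI[OF assms] by blast
  then show "linear (D u)" "D u u = 1" "\<And>x. x \<in> J \<Longrightarrow> D u x \<le> 1" using w by auto
qed

lemma legendre_eq_1:
  assumes "u \<in> J" "v \<in> J" "D u v = 1"
  shows "u = v"
  using functional_max_unique legendre_supports assms by blast

lemma legendre_less_1:
  assumes "u \<in> J" "v \<in> J" "u \<noteq> v"
  shows "D u v < 1"
  using legendre_eq_1 legendre_supports(3) assms less_eq_real_def by blast

section \<open>Lines through the dual sphere\<close>

lemma legendre_inj:
  assumes "u \<in> J" "v \<in> J" "D u = D v"
  shows "u = v"
  using legendre_eq_1 legendre_supports(2) assms by metis

text \<open>\<open>s \<mapsto> w q + s * \<xi> q\<close> is affine, equals 1 at \<open>b\<close> and
  is below 1 at \<open>a\<close> and \<open>c\<close> on both sides of it, which is impossible. Thus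
  \<open>D q\<close> never lies strictly between two other covectors of the dual sphere.\<close>

lemma legendre_not_between:
  assumes J: "p \<in> J" "q \<in> J" "r \<in> J" "p \<noteq> q" "r \<noteq> q" and ord: "a < b" "b < c"
    and D: "D p = (\<lambda>x. w x + a * \<xi> x)" "D q = (\<lambda>x. w x + b * \<xi> x)" "D r = (\<lambda>x. w x + c * \<xi> x)"
  shows False
proof -
  have "w q + b * \<xi> q = 1" using legendre_supports(2)[OF J(2)] D(2) by simp
  moreover have "w q + a * \<xi> q < 1" "w q + c * \<xi> q < 1"
    using legendre_less_1 J D(1,3) by metis+
  ultimately have "(b - a) * \<xi> q > 0" "(c - b) * \<xi> q < 0" by (auto simp: algebra_simps)
  then show False using ord by (auto simp: zero_less_mult_iff mult_less_0_iff)
qed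

text \<open>Reflections correspond to pairs of points of the dual unit sphere on a line
  \<open>D u + \<real> \<xi>\<close>; the dual unit sphere is strictly convex because \<open>J\<close> is smooth.\<close>

lemma reflection_unique:
  fixes \<xi> :: "'a \<Rightarrow> real"
  assumes \<xi>: "linear \<xi>" "\<xi> u \<noteq> 0" and J: "u \<in> J" "v \<in> J" "v' \<in> J" "v \<noteq> u" "v' \<noteq> u"
    and v: "\<And>h. \<xi> h = 0 \<Longrightarrow> D u h - D v h = 0" and v': "\<And>h. \<xi> h = 0 \<Longrightarrow> D u h - D v' h = 0"
  shows "v = v'"
proof (rule ccontr)
  assume ne: "v \<noteq> v'"
  \<comment> \<open>A covector vanishing on the kernel of \<open>\<xi>\<close> is a multiple of
    \<open>\<xi>\<close>; the factor is found by evaluating at \<open>u\<close>.\<close>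
  have on_line: "\<exists>s. D z = (\<lambda>x. D u x + s * \<xi> x)"
    if "z \<in> J" and z: "\<And>h. \<xi> h = 0 \<Longrightarrow> D u h - D z h = 0" for z
  proof -
    have "D z x = D u x + ((D z u - D u u) / \<xi> u) * \<xi> x" for x
    proof -
      have "\<xi> (x - (\<xi> x / \<xi> u) *\<^sub>R u) = 0" using \<xi> by (simp add: linear_diff linear_scale)
      from z[OF this] show ?thesis
        using legendre_supports(1)[OF \<open>z \<in> J\<close>] legendre_supports(1)[OF J(1)]
        by (simp add: linear_diff linear_scale algebra_simps diff_divide_distrib)
    qed
    then show ?thesis by blast
  qed
  obtain s s' where s: "D v = (\<lambda>x. D u x + s * \<xi> x)" "D v' = (\<lambda>x. D u x + s' * \<xi> x)"
    using on_line[OF J(2) v] on_line[OF J(3) v'] by blast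
  have u0: "D u = (\<lambda>x. D u x + 0 * \<xi> x)" by simp
  have "s \<noteq> 0" "s' \<noteq> 0" "s \<noteq> s'"
    using legendre_inj[of u v] legendre_inj[of u v'] legendre_inj[of v v'] J ne s by auto
  \<comment> \<open>The parameters 0, \<open>s\<close>, \<open>s'\<close> are distinct, so one of
    them is strictly between the other two; each of the six orders contradicts
    \<open>legendre_not_between\<close>.\<close>
  then consider "0 < s" "s < s'" | "0 < s'" "s' < s" | "s < 0" "0 < s'" | "s' < 0" "0 < s"
    | "s < s'" "s' < 0" | "s' < s" "s < 0" by linarith
  then show False
    using legendre_not_between[OF J(1,2,3) _ _ _ _ u0 s] legendre_not_between[OF J(1,3,2) _ _ _ _ u0 s(2,1)]
      legendre_not_between[OF J(2,1,3) _ _ _ _ s(1) u0 s(2)] legendre_not_between[OF J(3,1,2) _ _ _ _ s(2) u0 s(1)]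
      legendre_not_between[OF J(2,3,1) _ _ _ _ s u0] legendre_not_between[OF J(3,2,1) _ _ _ _ s(2,1) u0]
      J(4,5) ne by metis
qed

text \<open>Move from \<open>D u\<close> along \<open>- \<xi>\<close> inside the dual unit ball. The
  exit point is again a supporting covector, and its contact point is the required
  \<open>v\<close>.\<close>

lemma reflection_exists_aux:
  assumes \<xi>: "linear \<xi>" "\<xi> u > (0::real)" and u: "u \<in> J"
  shows "\<exists>v\<in>J. v \<noteq> u \<and> (\<forall>h. \<xi> h = 0 \<longrightarrow> D u h - D v h = 0)"
proof -
  note Du = legendre_supports[OF u]
  have cont: "continuous_on A w" if "linear w" for w :: "'a \<Rightarrow> real" and A
    using that linear_continuous_on linear_conv_bounded_linear by blast
  obtain C where C: "C > 0" "\<And>x. x \<in> J \<Longrightarrow> \<bar>\<xi> x\<bar> \<le> C"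
    using compact_imp_bounded[OF compact_continuous_image[OF cont[OF \<xi>(1)] compact_J]]
    unfolding bounded_pos by auto
  \<comment> \<open>Parameters for which the covector stays in the dual unit ball.\<close>
  define P where "P = {s. \<forall>x\<in>J. D u x + s * \<xi> x \<le> 1}"
  have "closed P"
  proof -
    have "P = (\<Inter>x\<in>J. {s. D u x + s * \<xi> x \<le> 1})" unfolding P_def by blast
    moreover have "closed {s. D u x + s * \<xi> x \<le> 1}" for x
      by (intro closed_Collect_le continuous_intros)
    ultimately show ?thesis by (simp add: closed_INT)
  qed
  \<comment> \<open>The test point is \<open>- u\<close>, where \<open>D u\<close> is -1.\<close>
  have bdd: "bdd_below P"
  proof (rule bdd_belowI)
    fix s assume "s \<in> P"
    then have "D u (- u) + s * \<xi> (- u) \<le> 1" using minus_mem[OF u] unfolding P_def by blast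
    then have "- 2 \<le> s * \<xi> u" using Du \<xi>(1) by (simp add: linear_neg)
    then show "- 2 / \<xi> u \<le> s" using \<xi>(2) by (simp only: pos_divide_le_eq)
  qed
  define s0 where "s0 = Inf P"
  have "0 \<in> P" using Du(3) by (simp add: P_def)
  then have s0: "s0 \<in> P" unfolding s0_def
    using closed_contains_Inf[OF _ bdd \<open>closed P\<close>] by blast
  have low: "s0 \<le> s" if "s \<in> P" for s unfolding s0_def using cInf_lower[OF that bdd] .
  have "s0 < 0"
  proof -
    \<comment> \<open>On \<open>?A\<close>, which excludes \<open>u\<close>, \<open>D u\<close>
      stays below 1 by the gap \<open>1 - D u y\<close>; since \<open>C\<close> bounds
      \<open>\<xi>\<close>, the parameter \<open>s\<close> uses up at most this gap. Where
      \<open>\<xi> > 0\<close>, a negative \<open>s\<close> only lowers the value.\<close>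
    let ?A = "J \<inter> {x. \<xi> x \<le> 0}"
    have "compact ?A"
      by (intro compact_Int_closed compact_J closed_Collect_le cont \<xi> continuous_on_const)
    moreover have "- u \<in> ?A" using minus_mem[OF u] \<xi> by (simp add: linear_neg)
    ultimately obtain y where y: "y \<in> ?A" "\<And>x. x \<in> ?A \<Longrightarrow> D u x \<le> D u y"
      using continuous_attains_sup[of ?A "D u"] cont[OF Du(1)] by blast
    have "y \<noteq> u" using y(1) \<xi>(2) by auto
    then have m: "D u y < 1" using legendre_less_1[OF u] y(1) by blast
    define s where "s = - (1 - D u y) / C"
    have "s < 0" using m C(1) by (simp add: s_def divide_less_0_iff)
    have "D u x + s * \<xi> x \<le> 1" if x: "x \<in> J" for x
    proof (cases "\<xi> x \<le> 0")
      case True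
      have "s * \<xi> x \<le> (- s) * C"
        using mult_left_mono[OF C(2)[OF x], of "- s"] True \<open>s < 0\<close> by simp
      also have "\<dots> = 1 - D u y" using C(1) by (simp add: s_def)
      finally show ?thesis using y(2)[of x] x True by simp
    next
      case False
      then have "s * \<xi> x \<le> 0" using \<open>s < 0\<close> by (simp add: mult_le_0_iff)
      then show ?thesis using Du(3)[OF x] by linarith
    qed
    then have "s \<in> P" by (simp add: P_def)
    then show ?thesis using low \<open>s < 0\<close> by fastforce
  qed
  let ?w = "\<lambda>x. D u x + s0 * \<xi> x"
  have lin: "linear ?w" using Du(1) \<xi>(1) by (simp add: linear_iff algebra_simps)
  obtain v where v: "v \<in> J" "\<And>x. x \<in> J \<Longrightarrow> ?w x \<le> ?w v"
    using continuous_attains_sup[OF compact_J nonempty cont[OF lin]] by blast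
  \<comment> \<open>If the maximum were below 1, lowering \<open>s0\<close> by the gap divided by
    \<open>C\<close> would stay in \<open>P\<close>, against minimality.\<close>
  have wv: "?w v = 1"
  proof (rule ccontr)
    assume "?w v \<noteq> 1"
    then have m: "?w v < 1" using s0 v(1) unfolding P_def by force
    define s where "s = s0 - (1 - ?w v) / C"
    have "D u x + s * \<xi> x \<le> 1" if x: "x \<in> J" for x
    proof -
      have "- ((1 - ?w v) / C) * \<xi> x \<le> ((1 - ?w v) / C) * C"
        using mult_left_mono[of "- \<xi> x" C "(1 - ?w v) / C"] C(1) C(2)[OF x] m by auto
      also have "\<dots> = 1 - ?w v" using C(1) by simp
      finally have "- ((1 - ?w v) / C) * \<xi> x \<le> 1 - ?w v" .
      moreover have "D u x + s * \<xi> x = ?w x + - ((1 - ?w v) / C) * \<xi> x"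
        unfolding s_def by (simp add: algebra_simps)
      ultimately show ?thesis using v(2)[OF x] by linarith
    qed
    then have "s \<in> P" by (simp add: P_def)
    moreover have "s < s0" using m C(1) by (simp add: s_def)
    ultimately show False using low by fastforce
  qed
  have "D v = ?w" using legendre_eqI[OF v(1) lin wv] v(2) wv by simp
  moreover have "v \<noteq> u" using wv Du(2) \<open>s0 < 0\<close> \<xi>(2) by auto
  ultimately show ?thesis using v(1) by auto
qed

lemma reflection_exists:
  assumes \<xi>: "linear \<xi>" "\<xi> u \<noteq> (0::real)" and u: "u \<in> J"
  shows "\<exists>v\<in>J. v \<noteq> u \<and> (\<forall>h. \<xi> h = 0 \<longrightarrow> D u h - D v h = 0)"
proof (cases "\<xi> u > 0")
  case True
  then show ?thesis using reflection_exists_aux \<xi>(1) u by blast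
next
  case False
  have "linear (\<lambda>x. - \<xi> x)" using \<xi>(1) by (simp add: linear_iff)
  then show ?thesis using reflection_exists_aux[of "\<lambda>x. - \<xi> x" u] False \<xi>(2) u by simp
qed

section \<open>The Finsler reflection\<close>

lemma finsler_reflection_eqI:
  assumes "linear \<xi>" "\<xi> u \<noteq> (0::real)" "u \<in> J" "v \<in> J" "v \<noteq> u"
    and "\<And>h. \<xi> h = 0 \<Longrightarrow> D u h - D v h = 0"
  shows "finsler_reflection J {h. \<xi> h = 0} u = v"
proof -
  have "(THE v. v \<in> J \<and> v \<noteq> u \<and> (\<forall>h\<in>{h. \<xi> h = 0}. D u h - D v h = 0)) = v"
  proof (rule the_equality)
    show "v \<in> J \<and> v \<noteq> u \<and> (\<forall>h\<in>{h. \<xi> h = 0}. D u h - D v h = 0)" using assms by blast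
    show "z = v" if "z \<in> J \<and> z \<noteq> u \<and> (\<forall>h\<in>{h. \<xi> h = 0}. D u h - D z h = 0)" for z
      using reflection_unique[OF assms(1,2,3), of z v] assms(4-6) that by blast
  qed
  then show ?thesis using assms(2) by (simp add: finsler_reflection_def)
qed

text \<open>Points of the hyperplane are fixed, so the agreement of covectors along it holds in
  every case; it supplies the common slopes in \<open>projective_isometry\<close>.\<close>

lemma finsler_reflection_mem:
  assumes "linear \<xi>" "u \<in> J"
  shows "finsler_reflection J {h. \<xi> h = (0::real)} u \<in> J"
    and "\<xi> h = 0 \<Longrightarrow> D (finsler_reflection J {h. \<xi> h = 0} u) h = D u h"
proof -
  have "finsler_reflection J {h. \<xi> h = 0} u \<in> J \<and>
    (\<forall>h. \<xi> h = 0 \<longrightarrow> D (finsler_reflection J {h. \<xi> h = 0} u) h = D u h)"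
  proof (cases "\<xi> u = 0")
    case True
    then show ?thesis using assms(2) by (simp add: finsler_reflection_def)
  next
    case False
    obtain v where v: "v \<in> J" "v \<noteq> u" "\<And>h. \<xi> h = 0 \<Longrightarrow> D u h - D v h = 0"
      using reflection_exists[OF assms(1) False assms(2)] by blast
    then show ?thesis
      using finsler_reflection_eqI[OF assms(1) False assms(2) v] by simp
  qed
  then show "finsler_reflection J {h. \<xi> h = (0::real)} u \<in> J"
    "\<xi> h = 0 \<Longrightarrow> D (finsler_reflection J {h. \<xi> h = 0} u) h = D u h" by blast+
qed

end


section \<open>Projective reflection laws\<close>

text \<open>Each increment of the difference is controlled by the variation of \<open>p\<close>
  times the step. Over \<open>n\<close> equal steps the variations telescope, leaving
  \<open>(p b - p a) * (b - a) / n\<close>, which tends to 0.\<close>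

lemma equal_subgradients_difference_constant:
  fixes \<phi> \<psi> p :: "real \<Rightarrow> real"
  assumes \<phi>: "\<And>s t. \<phi> s + p s * (t - s) \<le> \<phi> t" and \<psi>: "\<And>s t. \<psi> s + p s * (t - s) \<le> \<psi> t"
  shows "\<phi> b - \<psi> b = \<phi> a - \<psi> a"
proof -
  define d where "d t = \<phi> t - \<psi> t" for t
  \<comment> \<open>The increments of \<phi> and \<psi> both lie between
    \<open>p s * (t - s)\<close> and \<open>p t * (t - s)\<close>.\<close>
  have step: "\<bar>d t - d s\<bar> \<le> (p t - p s) * (t - s)" for s t
    using \<phi>[of s t] \<phi>[of t s] \<psi>[of s t] \<psi>[of t s] by (auto simp: d_def algebra_simps abs_le_iff)
  have bound: "\<bar>d b - d a\<bar> \<le> (p b - p a) * (b - a) / real n" if "n > 0" for n :: nat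
  proof -
    define \<delta> where "\<delta> = (b - a) / real n"
    define x where "x i = a + real i * \<delta>" for i :: nat
    have x: "x 0 = a" "x n = b" using that by (auto simp: x_def \<delta>_def)
    have "\<bar>d b - d a\<bar> = \<bar>\<Sum>i<n. d (x (Suc i)) - d (x i)\<bar>"
      using sum_lessThan_telescope[of "\<lambda>i. d (x i)" n] x by simp
    also have "\<dots> \<le> (\<Sum>i<n. \<bar>d (x (Suc i)) - d (x i)\<bar>)" by (rule sum_abs)
    also have "\<dots> \<le> (\<Sum>i<n. (p (x (Suc i)) - p (x i)) * \<delta>)"
    proof (rule sum_mono)
      fix i
      have "x (Suc i) - x i = \<delta>" by (simp add: x_def distrib_right)
      then show "\<bar>d (x (Suc i)) - d (x i)\<bar> \<le> (p (x (Suc i)) - p (x i)) * \<delta>"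
        using step[of "x (Suc i)" "x i"] by simp
    qed
    also have "\<dots> = (p b - p a) * \<delta>"
      unfolding sum_distrib_right[symmetric]
      using sum_lessThan_telescope[of "\<lambda>i. p (x i)" n] x by simp
    finally show ?thesis by (simp add: \<delta>_def)
  qed
  have "\<bar>d b - d a\<bar> \<le> 0"
  proof (rule LIMSEQ_le_const)
    show "(\<lambda>n. (p b - p a) * (b - a) / real n) \<longlonglongrightarrow> 0" by (rule lim_const_over_n)
    show "\<exists>N. \<forall>n\<ge>N. \<bar>d b - d a\<bar> \<le> (p b - p a) * (b - a) / real n"
      using bound by (intro exI[of _ 1]) auto
  qed
  then show ?thesis by (simp add: d_def)
qed

lemma complement_decomposition:
  fixes H N :: "'a::euclidean_space set"
  assumes "subspace H" "dim H + 1 = DIM('a)" "subspace N" "dim N = 1" "H \<inter> N = {0}"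
  obtains h n where "h \<in> H" "n \<in> N" "x = h + n"
proof -
  let ?W = "{h + n |h n. h \<in> H \<and> n \<in> N}"
  have "dim ?W = DIM('a)" using dim_sums_Int[OF assms(1,3)] assms by simp
  moreover have "subspace ?W" using subspace_sums[OF assms(1,3)] .
  ultimately have "?W = UNIV" using dim_eq_full[of ?W] span_eq_iff[of ?W] by simp
  then have "x \<in> ?W" by blast
  then show thesis using that by blast
qed

context symmetric_indicatrix
begin

section \<open>The Finsler norm in polar coordinates\<close>

abbreviation F :: "'a \<Rightarrow> real" where "F \<equiv> finsler_norm (\<lambda>_. J) 0"

lemma polar:
  obtains r u where "r \<ge> 0" "u \<in> J" "x = r *\<^sub>R u"
proof (cases "x = 0")
  case True
  then show ?thesis using nonempty that[of 0] by auto
next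
  case False
  then show ?thesis using ray_meets[OF False] that by (metis less_imp_le)
qed

text \<open>\<open>D u\<close> reads off \<open>r\<close> on the left side of the equation and gives
  at most \<open>s\<close> on the right.\<close>

lemma polar_le:
  assumes "r \<ge> 0" "s \<ge> 0" "u \<in> J" "v \<in> J" "r *\<^sub>R u = s *\<^sub>R v"
  shows "r \<le> s"
proof -
  have "r = D u (r *\<^sub>R u)" using legendre_supports[OF assms(3)] by (simp add: linear_scale)
  also have "\<dots> = s * D u v" using legendre_supports[OF assms(3)] assms(5) by (simp add: linear_scale)
  also have "\<dots> \<le> s" using legendre_supports(3)[OF assms(3,4)] assms(2) by (simp add: mult_left_le)
  finally show ?thesis .
qed

lemma norm_polar:
  assumes "r \<ge> 0" "u \<in> J"
  shows "F (r *\<^sub>R u) = r"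
  unfolding finsler_norm_def
proof (rule the_equality)
  show "0 \<le> r \<and> (\<exists>w\<in>J. r *\<^sub>R u = r *\<^sub>R w)" using assms by blast
  show "s = r" if s: "0 \<le> s \<and> (\<exists>w\<in>J. r *\<^sub>R u = s *\<^sub>R w)" for s
  proof -
    obtain w where "w \<in> J" "r *\<^sub>R u = s *\<^sub>R w" using s by blast
    then show ?thesis
      using polar_le[OF assms(1) _ assms(2), of s w] polar_le[OF _ assms(1) _ assms(2), of s w] s by simp
  qed
qed

lemma norm_eq_1: "x \<in> J \<longleftrightarrow> F x = 1"
proof
  show "F x = 1" if "x \<in> J" using norm_polar[of 1 x] that by simp
  show "x \<in> J" if "F x = 1"
  proof -
    obtain r u where "r \<ge> 0" "u \<in> J" "x = r *\<^sub>R u" by (rule polar)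
    then show ?thesis using norm_polar[of r u] that by simp
  qed
qed

lemma norm_minus: "F (- x) = F x"
proof -
  obtain r u where "r \<ge> 0" "u \<in> J" "x = r *\<^sub>R u" by (rule polar)
  then show ?thesis using norm_polar[of r u] norm_polar[of r "- u"] minus_mem by simp
qed

lemma norm_scale: "c \<ge> 0 \<Longrightarrow> F (c *\<^sub>R x) = c * F x"
proof -
  assume c: "c \<ge> 0"
  obtain r u where "r \<ge> 0" "u \<in> J" "x = r *\<^sub>R u" by (rule polar)
  then show ?thesis using norm_polar[of r u] norm_polar[of "c * r" u] c by simp
qed

text \<open>Equality holds on the ray through \<open>u\<close>, so \<open>D u\<close> is a
  subgradient of \<open>F\<close> there.\<close>

lemma legendre_le_norm:
  assumes "u \<in> J"
  shows "D u x \<le> F x"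
proof -
  obtain r v where "r \<ge> 0" "v \<in> J" "x = r *\<^sub>R v" by (rule polar)
  then show ?thesis
    using norm_polar[of r v] legendre_supports(1)[OF assms] legendre_supports(3)[OF assms]
    by (simp add: linear_scale mult_left_le)
qed

text \<open>The restrictions of \<open>F\<close> and \<open>F \<circ> \<sigma>\<close> to a line parallel to \<open>H\<close> have common subgradients by the
  reflection law, and the two functions agree on \<open>N\<close>.\<close>

lemma projective_isometry:
  assumes H: "subspace H" "dim H + 1 = DIM('a)" and N: "subspace N" "dim N = 1" "H \<inter> N = {0}"
    and \<sigma>: "linear \<sigma>" "\<And>h. h \<in> H \<Longrightarrow> \<sigma> h = h" "\<And>n. n \<in> N \<Longrightarrow> \<sigma> n = - n"
    and refl: "\<And>u. u \<in> J \<Longrightarrow> \<exists>c>0. finsler_reflection J H u = c *\<^sub>R \<sigma> u"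
  shows "F (\<sigma> x) = F x"
proof -
  obtain h n where x: "h \<in> H" "n \<in> N" "x = h + n"
    using complement_decomposition[OF H N] .
  obtain \<xi> :: "'a \<Rightarrow> real" where \<xi>: "linear \<xi>" "H = {h. \<xi> h = 0}"
    using hyperplane_kernel[OF H] .
  show ?thesis
  proof (cases "n = 0")
    case True
    then show ?thesis using x \<sigma>(2) by simp
  next
    case False
    then have "\<xi> n \<noteq> 0" using x(2) N(3) \<xi>(2) by blast
    \<comment> \<open>The slope is \<open>p = D u h\<close>, where \<open>u\<close> is the direction
      of \<open>n + s *\<^sub>R h\<close>. The reflected point \<open>v\<close>, in the direction of
      the image under \<open>\<sigma>\<close>, satisfies \<open>D v h = D u h\<close>, and
      \<open>\<sigma>\<close> fixes \<open>h\<close>, so this slope serves both functions.\<close>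
    have "\<exists>p. \<forall>t. F (n + s *\<^sub>R h) + p * (t - s) \<le> F (n + t *\<^sub>R h) \<and>
        F (\<sigma> (n + s *\<^sub>R h)) + p * (t - s) \<le> F (\<sigma> (n + t *\<^sub>R h))" for s
    proof -
      \<comment> \<open>\<open>\<xi>\<close> is constant and nonzero on the line, so the line misses
        0.\<close>
      have "\<xi> (n + s *\<^sub>R h) = \<xi> n" using x(1) \<xi> by (simp add: linear_add linear_scale)
      then have "n + s *\<^sub>R h \<noteq> 0" using \<open>\<xi> n \<noteq> 0\<close> \<xi>(1) by (metis linear_0)
      then obtain r u where u: "r > 0" "u \<in> J" "n + s *\<^sub>R h = r *\<^sub>R u" by (rule ray_meets)
      obtain c where c: "c > 0" "finsler_reflection J H u = c *\<^sub>R \<sigma> u" using refl[OF u(2)] by blast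
      define v where "v = c *\<^sub>R \<sigma> u"
      have v: "v \<in> J" "D v h = D u h"
        using finsler_reflection_mem[OF \<xi>(1) u(2)] c(2) \<xi>(2) x(1) by (auto simp: v_def)
      have \<sigma>s: "\<sigma> (n + s *\<^sub>R h) = (r / c) *\<^sub>R v"
        using u(3) \<sigma>(1) c(1) by (simp add: v_def linear_scale)
      have diff: "n + t *\<^sub>R h = (n + s *\<^sub>R h) + (t - s) *\<^sub>R h" for t
        by (simp add: algebra_simps)
      have "F (n + s *\<^sub>R h) + D u h * (t - s) \<le> F (n + t *\<^sub>R h)" for t
      proof -
        have "F (n + s *\<^sub>R h) + D u h * (t - s) = D u ((n + s *\<^sub>R h) + (t - s) *\<^sub>R h)"
          using u norm_polar[of r u] legendre_supports[OF u(2)]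
          by (simp add: linear_add linear_scale mult.commute)
        then show ?thesis using legendre_le_norm[OF u(2)] unfolding diff[of t] by metis
      qed
      moreover have "F (\<sigma> (n + s *\<^sub>R h)) + D u h * (t - s) \<le> F (\<sigma> (n + t *\<^sub>R h))" for t
      proof -
        have "\<sigma> (n + t *\<^sub>R h) = \<sigma> (n + s *\<^sub>R h) + (t - s) *\<^sub>R h"
          unfolding diff[of t] using \<sigma>(1,2) x(1) by (metis linear_add linear_scale)
        moreover have "F (\<sigma> (n + s *\<^sub>R h)) + D u h * (t - s) = D v (\<sigma> (n + s *\<^sub>R h) + (t - s) *\<^sub>R h)"
          unfolding \<sigma>s using u(1) c(1) norm_polar[of "r / c" v] legendre_supports[OF v(1)] v
          by (simp add: linear_add linear_scale mult.commute)
        ultimately show ?thesis using legendre_le_norm[OF v(1)] by simp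
      qed
      ultimately show ?thesis by blast
    qed
    then obtain p where p: "\<And>s t. F (n + s *\<^sub>R h) + p s * (t - s) \<le> F (n + t *\<^sub>R h)"
        "\<And>s t. F (\<sigma> (n + s *\<^sub>R h)) + p s * (t - s) \<le> F (\<sigma> (n + t *\<^sub>R h))"
      by metis
    \<comment> \<open>Parameter 1 gives the point \<open>x\<close>; at parameter 0 the difference is
      zero because \<open>\<sigma> n = - n\<close> and \<open>F\<close> is even.\<close>
    have "F (n + 1 *\<^sub>R h) - F (\<sigma> (n + 1 *\<^sub>R h)) = F (n + 0 *\<^sub>R h) - F (\<sigma> (n + 0 *\<^sub>R h))"
      by (rule equal_subgradients_difference_constant[where p = p]) (rule p)+
    then show ?thesis using \<sigma>(3)[OF x(2)] norm_minus[of n] x(3) by (simp add: add.commute)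
  qed
qed

end

locale projective_indicatrix = symmetric_indicatrix +
  assumes projective: "\<And>H. subspace H \<Longrightarrow> dim H + 1 = DIM('a) \<Longrightarrow>
    \<exists>N \<sigma>. subspace N \<and> dim N = 1 \<and> H \<inter> N = {0} \<and>
      linear \<sigma> \<and> (\<forall>h\<in>H. \<sigma> h = h) \<and> (\<forall>n\<in>N. \<sigma> n = - n) \<and>
      (\<forall>u\<in>J. \<exists>c>0. finsler_reflection J H u = c *\<^sub>R \<sigma> u)"
begin

text \<open>The positive factor allowed by projectivity is 1: the reflection stays in
  \<open>J\<close> and \<open>\<sigma>\<close> preserves \<open>F\<close>, so both
  \<open>\<sigma> u\<close> and its multiple have norm 1.\<close>

lemma reflection_linear:
  assumes H: "subspace H" "dim H + 1 = DIM('a)"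
  obtains N \<sigma> where "subspace N" "dim N = 1" "H \<inter> N = {0}"
    "linear \<sigma>" "\<And>h. h \<in> H \<Longrightarrow> \<sigma> h = h" "\<And>n. n \<in> N \<Longrightarrow> \<sigma> n = - n"
    "\<And>x. F (\<sigma> x) = F x" "\<And>u. u \<in> J \<Longrightarrow> finsler_reflection J H u = \<sigma> u"
proof -
  obtain N \<sigma> where N: "subspace N" "dim N = 1" "H \<inter> N = {0}"
    and \<sigma>: "linear \<sigma>" "\<And>h. h \<in> H \<Longrightarrow> \<sigma> h = h" "\<And>n. n \<in> N \<Longrightarrow> \<sigma> n = - n"
    and refl: "\<And>u. u \<in> J \<Longrightarrow> \<exists>c>0. finsler_reflection J H u = c *\<^sub>R \<sigma> u"
    using projective[OF H] by blast
  have iso: "F (\<sigma> x) = F x" for x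
    using projective_isometry[OF H N \<sigma> refl] .
  have "finsler_reflection J H u = \<sigma> u" if u: "u \<in> J" for u
  proof -
    obtain c where c: "c > 0" "finsler_reflection J H u = c *\<^sub>R \<sigma> u" using refl[OF u] by blast
    obtain \<xi> :: "'a \<Rightarrow> real" where \<xi>: "linear \<xi>" "H = {h. \<xi> h = 0}"
      using hyperplane_kernel[OF H] .
    have "F (c *\<^sub>R \<sigma> u) = 1"
      using finsler_reflection_mem(1)[OF \<xi>(1) u] c(2) \<xi>(2) norm_eq_1 by simp
    then have "c = 1" using norm_scale[of c "\<sigma> u"] iso[of u] c(1) norm_eq_1 u by simp
    then show ?thesis using c(2) by simp
  qed
  then show thesis using that N \<sigma> iso by blast
qed

text \<open>The reflection with respect to \<open>ker (D u - D v)\<close> swaps \<open>u\<close> and \<open>v\<close> and preserves \<open>J\<close>.\<close>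

lemma legendre_symmetric:
  assumes u: "u \<in> J" and v: "v \<in> J"
  shows "D u v = D v u"
proof (cases "u = v")
  case False
  define \<xi> where "\<xi> = (\<lambda>h. D u h - D v h)"
  have \<xi>: "linear \<xi>"
    using legendre_supports(1)[OF u] legendre_supports(1)[OF v] by (simp add: \<xi>_def linear_compose_sub)
  have \<xi>u: "\<xi> u \<noteq> 0"
    using legendre_less_1[OF v u] legendre_supports(2)[OF u] False by (simp add: \<xi>_def)
  then have nz: "\<xi> \<noteq> (\<lambda>_. 0)" by metis
  let ?H = "{h. \<xi> h = 0}"
  obtain N \<sigma> where N: "subspace N" "dim N = 1" "?H \<inter> N = {0}"
    and \<sigma>: "linear \<sigma>" "\<And>h. h \<in> ?H \<Longrightarrow> \<sigma> h = h" "\<And>n. n \<in> N \<Longrightarrow> \<sigma> n = - n"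
    and iso: "\<And>x. F (\<sigma> x) = F x" and refl: "\<And>u. u \<in> J \<Longrightarrow> finsler_reflection J ?H u = \<sigma> u"
    using reflection_linear[OF kernel_hyperplane[OF \<xi> nz]] by blast
  have "finsler_reflection J ?H u = v"
    using finsler_reflection_eqI[OF \<xi> \<xi>u u v] False by (simp add: \<xi>_def)
  then have "\<sigma> u = v" using refl[OF u] by simp
  have "\<sigma> (\<sigma> x) = x" for x
  proof -
    obtain h n where "h \<in> ?H" "n \<in> N" "x = h + n"
      using complement_decomposition[OF kernel_hyperplane[OF \<xi> nz] N] .
    then show ?thesis
      using \<sigma> by (simp add: linear_add linear_neg linear_diff)
  qed
  \<comment> \<open>Since \<open>\<sigma>\<close> is an involution preserving \<open>J\<close> with
    \<open>\<sigma> v = u\<close>, \<open>D u \<circ> \<sigma>\<close> supports \<open>J\<close> at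
    \<open>v\<close>. Evaluating at \<open>u\<close> gives the symmetry.\<close>
  then have "D v = D u \<circ> \<sigma>"
    using \<open>\<sigma> u = v\<close> legendre_supports[OF u] \<sigma>(1) iso norm_eq_1
    by (intro legendre_eqI[OF v]) (auto intro: linear_compose)
  then show ?thesis using \<open>\<sigma> u = v\<close> by simp
qed simp

text \<open>The inner product whose unit sphere is \<open>J\<close> is the differential of \<open>F\<^sup>2 / 2\<close>.\<close>

definition form :: "'a \<Rightarrow> 'a \<Rightarrow> real" where
  "form x y = F x * D ((1 / F x) *\<^sub>R x) y"

text \<open>For \<open>r = 0\<close> the factor \<open>F 0\<close> is 0, whatever value
  \<open>D\<close> takes at 0.\<close>

lemma form_polar:
  assumes "r \<ge> 0" "u \<in> J"
  shows "form (r *\<^sub>R u) y = r * D u y"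
  using norm_polar[OF assms] by (simp add: form_def)

text \<open>In polar coordinates both sides are \<open>r * s\<close> times a Legendre pairing. With
  \<open>form_linear\<close> this makes \<open>form\<close> bilinear.\<close>

lemma form_symmetric: "form x y = form y x"
proof -
  obtain r u where u: "r \<ge> 0" "u \<in> J" "x = r *\<^sub>R u" by (rule polar)
  obtain s v where v: "s \<ge> 0" "v \<in> J" "y = s *\<^sub>R v" by (rule polar)
  show ?thesis
    using form_polar[OF u(1,2), of y] form_polar[OF v(1,2), of x] u v legendre_symmetric[OF u(2) v(2)]
      legendre_supports(1)[OF u(2)] legendre_supports(1)[OF v(2)]
    by (simp add: linear_scale)
qed

lemma form_linear: "linear (form x)"
proof -
  obtain r u where u: "r \<ge> 0" "u \<in> J" "x = r *\<^sub>R u" by (rule polar)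
  then have "form x = (\<lambda>y. r * D u y)" using form_polar by auto
  then show ?thesis using legendre_supports(1)[OF u(2)] by (simp add: linear_iff algebra_simps)
qed

lemma form_diagonal: "form x x = (F x)\<^sup>2"
proof -
  obtain r u where u: "r \<ge> 0" "u \<in> J" "x = r *\<^sub>R u" by (rule polar)
  then show ?thesis
    using form_polar[OF u(1,2), of x] norm_polar[OF u(1,2)] legendre_supports[OF u(2)]
    by (simp add: linear_scale power2_eq_square)
qed

lemma norm_pos: "x \<noteq> 0 \<Longrightarrow> F x > 0"
  using ray_meets norm_polar by (metis less_imp_le)

end


section \<open>Euclidean coordinates\<close>

text \<open>A \<open>B\<close>-orthonormal set of largest size is a basis; \<open>T\<close> sends
  \<open>B\<close>-coordinates to Euclidean ones.\<close>

lemma positive_form_orthonormal_basis: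
  fixes B :: "'a::euclidean_space \<Rightarrow> 'a \<Rightarrow> real"
  assumes lin: "\<And>x. linear (B x)" and sym: "\<And>x y. B x y = B y x" and pos: "\<And>x. x \<noteq> 0 \<Longrightarrow> B x x > 0"
  obtains T :: "'a \<Rightarrow> 'a" where "linear T" "bij T" "\<And>x. (norm (T x))\<^sup>2 = B x x"
proof -
  define orth where "orth S \<longleftrightarrow> finite S \<and> (\<forall>s\<in>S. \<forall>t\<in>S. B s t = (if s = t then 1 else 0))" for S
  have coeff: "B t (\<Sum>s\<in>S. f s *\<^sub>R s) = f t" if "orth S" "t \<in> S" for S t and f :: "'a \<Rightarrow> real"
  proof -
    have "B t (\<Sum>s\<in>S. f s *\<^sub>R s) = (\<Sum>s\<in>S. f s * B t s)"
      using lin[of t] by (simp add: linear_sum linear_scale)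
    also have "\<dots> = (\<Sum>s\<in>S. if s = t then f s else 0)"
      using that by (intro sum.cong) (auto simp: orth_def)
    also have "\<dots> = f t" using that by (simp add: orth_def)
    finally show ?thesis .
  qed
  \<comment> \<open>Orthonormal sets are independent, so a largest one exists.\<close>
  have card_le: "card S \<le> DIM('a)" if "orth S" for S
  proof -
    have "independent S"
    proof (rule independent_if_scalars_zero)
      show "finite S" using that orth_def by blast
      show "f x = 0" if "(\<Sum>x\<in>S. f x *\<^sub>R x) = 0" "x \<in> S" for f :: "'a \<Rightarrow> real" and x
        using coeff[OF \<open>orth S\<close> that(2), of f] that(1) linear_0[OF lin[of x]] by simp
    qed
    then show ?thesis using independent_bound by blast
  qed
  have "orth {}" by (simp add: orth_def)
  moreover have "\<forall>S. orth S \<longrightarrow> card S < Suc DIM('a)" using card_le by (simp add: less_Suc_eq_le)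
  ultimately obtain S where S: "orth S" "\<And>S'. orth S' \<Longrightarrow> card S' \<le> card S"
    using ex_has_greatest_nat[of orth "{}" card "Suc DIM('a)"] by blast
  have fin: "finite S" using S(1) orth_def by blast
  \<comment> \<open>Otherwise the remainder after projection, normalized, could be added to
    \<open>S\<close>, contradicting maximality.\<close>
  have expand: "x = (\<Sum>s\<in>S. B s x *\<^sub>R s)" for x
  proof (rule ccontr)
    assume ne: "x \<noteq> (\<Sum>s\<in>S. B s x *\<^sub>R s)"
    define e where "e = x - (\<Sum>s\<in>S. B s x *\<^sub>R s)"
    have e: "B e e > 0" using ne pos by (simp add: e_def)
    have orth_e: "B t e = 0" if "t \<in> S" for t
      using coeff[OF S(1) that, of "\<lambda>s. B s x"] lin[of t] by (simp add: e_def linear_diff)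
    define f where "f = (1 / sqrt (B e e)) *\<^sub>R e"
    have scale: "B y f = (1 / sqrt (B e e)) * B y e" for y
      using lin[of y] by (simp add: f_def linear_scale)
    have "B f f = B e e / (sqrt (B e e) * sqrt (B e e))"
      using scale[of f] scale[of e] sym[of e f] by simp
    then have "B f f = 1" using e by simp
    moreover have "B t f = 0" if "t \<in> S" for t using orth_e[OF that] scale by simp
    ultimately have "f \<notin> S" "orth (insert f S)"
      using S(1) sym unfolding orth_def by (auto; metis zero_neq_one)+
    then show False using S(2)[of "insert f S"] fin by simp
  qed
  have "x \<in> span S" for x
    using expand[of x] span_sum[of S "\<lambda>s. B s x *\<^sub>R s" S] span_base span_scale by metis
  then have "DIM('a) \<le> card S"
    using dim_le_card[of UNIV S] fin by (simp add: subset_eq)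
  then have "card (Basis :: 'a set) = card S" using card_le[OF S(1)] by simp
  \<comment> \<open>\<open>\<phi>\<close> labels \<open>S\<close> by the standard basis, so that
    \<open>T\<close> can place the coordinate along \<open>\<phi> b\<close> on the axis
    \<open>b\<close>.\<close>
  then obtain \<phi> :: "'a \<Rightarrow> 'a" where \<phi>: "bij_betw \<phi> Basis S"
    using finite_same_card_bij[OF finite_Basis fin] by blast
  define T where "T x = (\<Sum>b\<in>Basis. B (\<phi> b) x *\<^sub>R b)" for x
  have linT: "linear T"
    using lin by (auto simp: T_def linear_iff scaleR_add_left sum.distrib scaleR_sum_right)
  have norm: "(norm (T x))\<^sup>2 = B x x" for x
  proof -
    have comp: "T x \<bullet> b = B (\<phi> b) x" if "b \<in> Basis" for b
      using that by (simp add: T_def)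
    have "(norm (T x))\<^sup>2 = (\<Sum>b\<in>Basis. (T x \<bullet> b) * (T x \<bullet> b))"
      using euclidean_inner[of "T x" "T x"] by (simp add: power2_norm_eq_inner)
    also have "\<dots> = (\<Sum>b\<in>Basis. B (\<phi> b) x * B (\<phi> b) x)" using comp by simp
    also have "\<dots> = (\<Sum>s\<in>S. B s x * B s x)"
      using sum.reindex_bij_betw[OF \<phi>, of "\<lambda>s. B s x * B s x"] .
    also have "\<dots> = (\<Sum>s\<in>S. B s x * B x s)" using sym by simp
    also have "\<dots> = B x (\<Sum>s\<in>S. B s x *\<^sub>R s)"
      using lin[of x] by (simp add: linear_sum linear_scale)
    also have "\<dots> = B x x" using expand[of x] by simp
    finally show ?thesis .
  qed
  have "inj T"
  proof (subst linear_injective_0[OF linT], intro allI impI)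
    show "x = 0" if "T x = 0" for x using norm[of x] pos[of x] that by fastforce
  qed
  then have "bij T" using linear_injective_imp_surjective[OF linT] by (simp add: bij_def)
  then show thesis using that linT norm by blast
qed

text \<open>Equality in the triangle inequality of the Euclidean norm forces consecutive chords to
  point the same way.\<close>

lemma unit_speed_isometry_is_line:
  fixes \<gamma> :: "real \<Rightarrow> 'a::euclidean_space"
  assumes "\<And>a b. a \<le> b \<Longrightarrow> norm (\<gamma> b - \<gamma> a) = b - a"
  obtains v where "norm v = 1" "\<gamma> = (\<lambda>t. \<gamma> 0 + t *\<^sub>R v)"
proof -
  define v where "v = \<gamma> 1 - \<gamma> 0"
  have add: "(b - a) *\<^sub>R (\<gamma> c - \<gamma> b) = (c - b) *\<^sub>R (\<gamma> b - \<gamma> a)" if "a \<le> b" "b \<le> c" for a b c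
  proof -
    have "norm ((\<gamma> b - \<gamma> a) + (\<gamma> c - \<gamma> b)) = norm (\<gamma> b - \<gamma> a) + norm (\<gamma> c - \<gamma> b)"
      using assms[of a b] assms[of b c] assms[of a c] that by simp
    then show ?thesis
      using norm_triangle_eq[of "\<gamma> b - \<gamma> a" "\<gamma> c - \<gamma> b"] assms[of a b] assms[of b c] that by simp
  qed
  have "\<gamma> t = \<gamma> 0 + t *\<^sub>R v" for t
  proof -
    \<comment> \<open>The times 0, 1, \<open>t\<close> have to be taken in increasing order.\<close>
    consider "t \<le> 0" | "0 \<le> t" "t \<le> 1" | "1 \<le> t" by linarith
    then show ?thesis
    proof cases
      case 1
      then show ?thesis using add[of t 0 1] by (simp add: v_def algebra_simps)
    next
      case 2
      then show ?thesis using add[of 0 t 1] by (simp add: v_def algebra_simps)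
    next
      case 3
      have "(t - 1) *\<^sub>R v = \<gamma> t - \<gamma> 1" using add[of 0 1 t] 3 by (simp add: v_def)
      then show ?thesis by (simp add: v_def algebra_simps)
    qed
  qed
  moreover have "norm v = 1" using assms[of 0 1] by (simp add: v_def)
  ultimately show thesis using that by blast
qed

section \<open>The indicatrix and its reflections in Euclidean coordinates\<close>

context projective_indicatrix
begin

lemma euclidean_coordinates:
  obtains T :: "'a \<Rightarrow> 'a" where "linear T" "bij T" "\<And>x. norm (T x) = F x"
proof -
  have F0: "F x \<ge> 0" for x
    using norm_pos[of x] norm_polar[of 0] nonempty by (cases "x = 0") auto
  have "form x x > 0" if "x \<noteq> 0" for x using norm_pos[OF that] by (simp add: form_diagonal)
  then obtain T :: "'a \<Rightarrow> 'a" where T: "linear T" "bij T" "\<And>x. (norm (T x))\<^sup>2 = form x x"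
    using positive_form_orthonormal_basis[of form] form_linear form_symmetric by metis
  have "norm (T x) = F x" for x
    using T(3)[of x] F0[of x] by (simp add: form_diagonal)
  then show thesis using that T by blast
qed

text \<open>The normal is \<open>T m\<close> for \<open>m\<close> spanning \<open>N\<close>:
  \<open>\<sigma>\<close> maps \<open>h + m\<close> to \<open>h - m\<close> isometrically, and equal
  Euclidean norms mean that \<open>T h\<close> and \<open>T m\<close> are orthogonal.\<close>

lemma reflection_in_euclidean_coordinates:
  assumes T: "linear T" "\<And>x. norm (T x) = F x" and H: "subspace H" "dim H + 1 = DIM('a)"
  obtains \<nu> :: "'b::euclidean_space" where "\<nu> \<noteq> 0" "\<And>h. h \<in> H \<Longrightarrow> \<nu> \<bullet> T h = 0"
    "\<And>u. u \<in> J \<Longrightarrow> T (finsler_reflection J H u) = T u - (2 * (T u \<bullet> \<nu>) / (\<nu> \<bullet> \<nu>)) *\<^sub>R \<nu>"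
proof -
  obtain N \<sigma> where N: "subspace N" "dim N = 1" "H \<inter> N = {0}"
    and \<sigma>: "linear \<sigma>" "\<And>h. h \<in> H \<Longrightarrow> \<sigma> h = h" "\<And>n. n \<in> N \<Longrightarrow> \<sigma> n = - n"
    and iso: "\<And>x. F (\<sigma> x) = F x" and refl: "\<And>u. u \<in> J \<Longrightarrow> finsler_reflection J H u = \<sigma> u"
    using reflection_linear[OF H] by blast
  obtain m where m: "m \<in> N" "m \<noteq> 0"
    using N(2) dim_eq_0[of N] by fastforce
  have "span {m} = N"
    using m N(1,2) by (intro subspace_dim_equal) (auto simp: span_minimal)
  have nz: "T m \<noteq> 0" using T(2)[of m] norm_pos[OF m(2)] by auto
  have orth: "T m \<bullet> T h = 0" if h: "h \<in> H" for h
  proof -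
    have "\<sigma> (h + m) = h - m" using \<sigma> h m by (simp add: linear_add)
    then have "norm (T (h + m)) = norm (T (h - m))" using iso[of "h + m"] T(2) by simp
    then have "norm (T h + T m) = norm (T h - T m)" using T(1) by (simp add: linear_add linear_diff)
    then have "(T h + T m) \<bullet> (T h + T m) = (T h - T m) \<bullet> (T h - T m)"
      by (simp add: norm_eq)
    then show ?thesis by (simp add: inner_add_left inner_add_right inner_diff_left inner_diff_right inner_commute)
  qed
  have "T (finsler_reflection J H u) = T u - (2 * (T u \<bullet> T m) / (T m \<bullet> T m)) *\<^sub>R T m"
    if u: "u \<in> J" for u
  proof -
    obtain h n where hn: "h \<in> H" "n \<in> N" "u = h + n"
      using complement_decomposition[OF H N] .
    obtain a where a: "n = a *\<^sub>R m" using hn(2) \<open>span {m} = N\<close> by (auto simp: span_singleton)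
    have "\<sigma> u = h - a *\<^sub>R m" using \<sigma> hn a by (simp add: linear_add)
    then have "T (finsler_reflection J H u) = T h - a *\<^sub>R T m"
      using refl[OF u] T(1) by (simp add: linear_diff linear_scale)
    moreover have Tu: "T u = T h + a *\<^sub>R T m"
      using hn(3) a T(1) by (simp add: linear_add linear_scale)
    moreover have "T u \<bullet> T m = a * (T m \<bullet> T m)"
      using orth[OF hn(1)] by (simp add: Tu inner_add_left inner_commute[of "T h"])
    ultimately show ?thesis using nz by (simp add: scaleR_2 flip: scaleR_scaleR)
  qed
  then show thesis using that[of "T m"] nz orth by blast
qed

end


section \<open>Geodesics and billiards\<close>

lemma finsler_norm_euclidean:
  fixes T :: "'a::euclidean_space \<Rightarrow> 'a"
  assumes T: "linear T" "bij T" and I: "I x = {y. norm (T y) = 1}"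
  shows "finsler_norm I x v = norm (T v)"
  unfolding finsler_norm_def
proof (rule the_equality)
  show "r = norm (T v)" if "0 \<le> r \<and> (\<exists>w\<in>I x. v = r *\<^sub>R w)" for r
    using that T(1) I by (auto simp: linear_scale)
  show "0 \<le> norm (T v) \<and> (\<exists>w\<in>I x. v = norm (T v) *\<^sub>R w)"
  proof (cases "v = 0")
    case True
    \<comment> \<open>For \<open>v = 0\<close> the definition still asks for a point of the
      indicatrix: a preimage of a unit basis vector.\<close>
    obtain b :: 'a where "b \<in> Basis" by fastforce
    moreover obtain w where "T w = b" using T(2) by (metis bij_pointE)
    ultimately have "w \<in> I x" using I by simp
    then show ?thesis using True linear_0[OF T(1)] by auto
  next
    case False
    then have nz: "norm (T v) \<noteq> 0"
      using T linear_injective_0[OF T(1)] bij_is_inj by auto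
    then have "(1 / norm (T v)) *\<^sub>R v \<in> I x" using T(1) I by (simp add: linear_scale)
    then show ?thesis using nz by (intro conjI bexI[of _ "(1 / norm (T v)) *\<^sub>R v"]) auto
  qed
qed

text \<open>Comparison with the chord shows that the chord from \<open>\<gamma> a\<close> to \<open>\<gamma> b\<close> has length at least \<open>b - a\<close>,
  and it has at most this length because \<open>\<gamma>\<close> has unit speed.\<close>

lemma finsler_geodesic_isometry:
  fixes T :: "'a::euclidean_space \<Rightarrow> 'a"
  assumes T: "linear T" "bij T" and I: "\<And>x. I x = {y. norm (T y) = 1}"
    and geo: "finsler_geodesic I \<gamma>" and ab: "a \<le> b"
  shows "norm (T (\<gamma> b) - T (\<gamma> a)) = b - a"
proof (cases "a = b")
  case False
  then have "a < b" using ab by simp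
  have blT: "bounded_linear T" using T(1) linear_conv_bounded_linear by blast
  have C1: "\<gamma> C1_differentiable_on UNIV" and unit: "\<And>t. norm (T (vector_derivative \<gamma> (at t))) = 1"
    and min: "\<And>a b c. a \<le> b \<Longrightarrow> c piecewise_C1_differentiable_on {a..b} \<Longrightarrow> c a = \<gamma> a \<Longrightarrow> c b = \<gamma> b \<Longrightarrow>
        finsler_length I a b \<gamma> \<le> finsler_length I a b c"
    using geo I unfolding finsler_geodesic_def by blast+
  \<comment> \<open>Covers both curves: \<open>\<gamma>\<close> with \<open>m = 1\<close> and the
    chord with \<open>m = norm (T w)\<close>.\<close>
  have len: "finsler_length I a b c = ennreal (m * (b - a))"
    if "\<And>t. norm (T (vector_derivative c (at t))) = m" for c m
  proof -
    have "m \<ge> 0" using that[of 0] norm_ge_zero by metis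
    have "finsler_length I a b c = (\<integral>\<^sup>+ t\<in>{a..b}. ennreal m \<partial>lborel)"
      unfolding finsler_length_def finsler_norm_euclidean[OF T I] that ..
    also have "\<dots> = ennreal m * ennreal (b - a)"
      using ab by (simp add: nn_integral_cmult_indicator)
    finally show ?thesis using \<open>m \<ge> 0\<close> ab by (simp add: ennreal_mult)
  qed
  \<comment> \<open>The chord is run through in the same time from \<open>a\<close> to
    \<open>b\<close>, with constant velocity \<open>w\<close>.\<close>
  define w where "w = (1 / (b - a)) *\<^sub>R (\<gamma> b - \<gamma> a)"
  define c where "c t = \<gamma> a + (t - a) *\<^sub>R w" for t
  have dc: "(c has_vector_derivative w) (at t)" for t
    unfolding c_def by (auto intro!: derivative_eq_intros)
  have "c C1_differentiable_on {a..b}"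
    unfolding C1_differentiable_on_def using dc by (intro exI[of _ "\<lambda>_. w"]) auto
  then have "c piecewise_C1_differentiable_on {a..b}" by (rule C1_differentiable_imp_piecewise)
  moreover have "c a = \<gamma> a" "c b = \<gamma> b" using \<open>a < b\<close> by (simp_all add: c_def w_def)
  ultimately have "finsler_length I a b \<gamma> \<le> finsler_length I a b c" using min[OF ab] by blast
  moreover have "finsler_length I a b \<gamma> = ennreal (1 * (b - a))" using len unit by blast
  moreover have "finsler_length I a b c = ennreal (norm (T w) * (b - a))"
    using len[of c] vector_derivative_at[OF dc] by simp
  ultimately have "b - a \<le> norm (T w) * (b - a)" by (simp add: ennreal_le_iff \<open>a < b\<close> less_imp_le)
  moreover have "norm (T w) * (b - a) = norm (T (\<gamma> b) - T (\<gamma> a))"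
  proof -
    have "T w = (1 / (b - a)) *\<^sub>R (T (\<gamma> b) - T (\<gamma> a))"
      unfolding w_def using T(1) by (simp only: linear_scale linear_diff)
    then show ?thesis using \<open>a < b\<close> by (simp only: norm_scaleR) simp
  qed
  ultimately have lower: "b - a \<le> norm (T (\<gamma> b) - T (\<gamma> a))" by simp
  have "norm (T (\<gamma> b) - T (\<gamma> a)) \<le> 1 * norm (b - a)"
  proof (rule differentiable_bound)
    show "convex (UNIV :: real set)" by simp
    fix t :: real
    let ?v = "T (vector_derivative \<gamma> (at t))"
    have "(\<gamma> has_vector_derivative vector_derivative \<gamma> (at t)) (at t)"
      using C1 C1_differentiable_on_eq vector_derivative_works by blast
    then have "((\<lambda>t. T (\<gamma> t)) has_vector_derivative ?v) (at t)"
      by (rule bounded_linear.has_vector_derivative[OF blT])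
    then show "((\<lambda>t. T (\<gamma> t)) has_derivative (\<lambda>h. h *\<^sub>R ?v)) (at t within UNIV)"
      unfolding has_vector_derivative_def by simp
    show "onorm (\<lambda>h. h *\<^sub>R ?v) \<le> 1"
      by (rule onorm_le) (simp add: unit)
  qed auto
  then show ?thesis using lower \<open>a < b\<close> by simp
qed simp

text \<open>\<open>Q\<close> is the Gram matrix of \<open>T\<close>; injectivity of \<open>T\<close>
  makes it positive definite.\<close>

lemma ellipsoid_linear_preimage_sphere:
  fixes T :: "real ^ 'n \<Rightarrow> real ^ 'n"
  assumes T: "linear T" "bij T"
  shows "ellipsoid {x. norm (T x) = 1}"
proof -
  define Q where "Q = transpose (matrix T) ** matrix T"
  have Q: "x \<bullet> (Q *v x) = (norm (T x))\<^sup>2" for x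
  proof -
    have "Q *v x = T x v* matrix T"
      using T(1) by (simp add: Q_def transpose_matrix_vector flip: matrix_vector_mul_assoc)
    then show ?thesis
      by (simp add: inner_commute[of x] dot_lmul_matrix T(1) power2_norm_eq_inner)
  qed
  have "transpose Q = Q"
    by (simp add: Q_def matrix_transpose_mul transpose_transpose)
  moreover have "x \<bullet> (Q *v x) > 0" if "x \<noteq> 0" for x
    using that T linear_injective_0[OF T(1)] bij_is_inj unfolding Q by auto
  moreover have "{x. norm (T x) = 1} = {x. (x - 0) \<bullet> (Q *v (x - 0)) = 1}"
    by (simp add: Q abs_square_eq_1)
  ultimately show ?thesis unfolding ellipsoid_def by blast
qed

theorem corollary1p16:
  fixes I :: "real ^ 'n \<Rightarrow> (real ^ 'n) set"
  assumes "minkowski_structure I"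
    and "projective_reflection_law I"
  shows "ellipsoid (I 0) \<and>
    (\<exists>A. affine_transformation A \<and>
         sends_structure A I euclidean_structure \<and>
         (\<forall>S. strictly_convex_closed_hypersurface S \<longrightarrow>
            strictly_convex_closed_hypersurface (A ` S) \<and>
            (\<forall>g. finsler_billiard_orbit I S g \<longrightarrow>
                 euclidean_billiard_orbit (A ` S) (\<lambda>k. A \<circ> g k))))"
proof -
  have trans: "I x = I 0" for x
    using assms(1) unfolding minkowski_structure_def by blast
  \<comment> \<open>Translation invariance reduces the law at all points to the one indicatrix
    \<open>I 0\<close>.\<close>
  interpret projective_indicatrix "I 0"
  proof
    show "strictly_convex_closed_hypersurface (I 0)" "uminus ` I 0 = I 0"
      using assms(1) unfolding minkowski_structure_def finsler_structure_def by blast+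
  qed (use assms(2) projective_reflection_law_def in blast)
  obtain T :: "real ^ 'n \<Rightarrow> real ^ 'n" where T: "linear T" "bij T" and nT: "\<And>x. norm (T x) = F x"
    using euclidean_coordinates by blast
  have I: "I x = {y. norm (T y) = 1}" for x
    using trans[of x] norm_eq_1 nT by auto
  have blT: "bounded_linear T" using T(1) linear_conv_bounded_linear by blast
  have inj: "inj T" using T(2) by (rule bij_is_inj)
  \<comment> \<open>In the coordinates \<open>T\<close> a geodesic covers Euclidean distance equal
    to the elapsed time.\<close>
  have line: "oriented_line (T \<circ> \<gamma>)" if "finsler_geodesic I \<gamma>" for \<gamma>
    using unit_speed_isometry_is_line[of "T \<circ> \<gamma>"] finsler_geodesic_isometry[OF T I that]
    unfolding oriented_line_def by (metis comp_apply)
  have deriv: "vector_derivative (T \<circ> \<gamma>) (at t) = T (vector_derivative \<gamma> (at t))"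
    if "finsler_geodesic I \<gamma>" for \<gamma> t
  proof -
    have "(\<gamma> has_vector_derivative vector_derivative \<gamma> (at t)) (at t)"
      using that C1_differentiable_on_eq vector_derivative_works
      unfolding finsler_geodesic_def by blast
    then have "((\<lambda>t. T (\<gamma> t)) has_vector_derivative T (vector_derivative \<gamma> (at t))) (at t)"
      by (rule bounded_linear.has_vector_derivative[OF blT])
    then show ?thesis unfolding comp_def by (rule vector_derivative_at)
  qed
  have billiard: "euclidean_billiard (T ` S) (T \<circ> \<gamma>) (T \<circ> \<delta>)"
    if S: "strictly_convex_closed_hypersurface S" and b: "finsler_billiard I S \<gamma> \<delta>" for S \<gamma> \<delta>
  proof -
    obtain s t where geo: "finsler_geodesic I \<gamma>" "finsler_geodesic I \<delta>"
      and st: "\<gamma> s \<in> S" "\<And>r. r > s \<Longrightarrow> \<gamma> r \<notin> S" "\<delta> t = \<gamma> s"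
      and refl: "vector_derivative \<delta> (at t) =
          finsler_reflection (I (\<gamma> s)) (tangent_space S (\<gamma> s)) (vector_derivative \<gamma> (at s))"
      using b unfolding finsler_billiard_def by blast
    let ?H = "tangent_space S (\<gamma> s)" and ?u = "vector_derivative \<gamma> (at s)"
    have "smooth_hypersurface S"
      using S unfolding strictly_convex_closed_hypersurface_def by blast
    \<comment> \<open>The projective law speaks of hyperplanes; the tangent space is one, being the
      kernel of a nonzero functional.\<close>
    then obtain \<phi> :: "real ^ 'n \<Rightarrow> real" where "linear \<phi>" "\<phi> \<noteq> (\<lambda>_. 0)" "?H = {h. \<phi> h = 0}"
      using tangent_space_eq_kernel st(1) by blast
    then have H: "subspace ?H" "dim ?H + 1 = DIM(real ^ 'n)"
      using kernel_hyperplane[of \<phi>] by simp_all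
    obtain \<nu> where \<nu>: "\<nu> \<noteq> 0" "\<And>h. h \<in> ?H \<Longrightarrow> \<nu> \<bullet> T h = 0"
      "\<And>u. u \<in> I 0 \<Longrightarrow> T (finsler_reflection (I 0) ?H u) = T u - (2 * (T u \<bullet> \<nu>) / (\<nu> \<bullet> \<nu>)) *\<^sub>R \<nu>"
      using reflection_in_euclidean_coordinates[OF T(1) nT H] by blast
    have "?u \<in> I 0" using geo(1) trans unfolding finsler_geodesic_def by blast
    then have "T (vector_derivative \<delta> (at t)) = reflect_along \<nu> (T ?u)"
      using \<nu>(3) refl trans[of "\<gamma> s"] by (simp add: reflect_along_def)
    then have "vector_derivative (T \<circ> \<delta>) (at t) = reflect_along \<nu> (vector_derivative (T \<circ> \<gamma>) (at s))"
      using deriv geo by simp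
    moreover have "\<forall>h\<in>tangent_space (T ` S) ((T \<circ> \<gamma>) s). \<nu> \<bullet> h = 0"
      using tangent_space_linear_image[OF T, of S "\<gamma> s"] \<nu>(2) by auto
    \<comment> \<open>\<open>T\<close> is injective, so the time of the last intersection is the
      same for the image.\<close>
    moreover have "\<forall>r>s. (T \<circ> \<gamma>) r \<notin> T ` S"
      using st(2) inj by (auto simp: inj_image_mem_iff)
    ultimately show ?thesis
      unfolding euclidean_billiard_def using line geo st(1,3) \<nu>(1)
      by (intro conjI exI[of _ s] exI[of _ t] exI[of _ \<nu>]) auto
  qed
  \<comment> \<open>The affine map is \<open>T\<close> itself, with zero translation part.\<close>
  have "affine_transformation T"
    unfolding affine_transformation_def using T by (intro exI[of _ T] exI[of _ 0]) auto
  moreover have "sends_structure T I euclidean_structure"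
  proof -
    have "frechet_derivative T (at x) = T" for x
      using frechet_derivative_at[OF bounded_linear_imp_has_derivative[OF blT]] by metis
    moreover have "T ` {y. norm (T y) = 1} = sphere 0 1"
      using bij_is_surj[OF T(2)] by (auto simp: image_iff) (metis surjD)
    ultimately show ?thesis unfolding sends_structure_def euclidean_structure_def I by simp
  qed
  ultimately show ?thesis
    using ellipsoid_linear_preimage_sphere[OF T] I[of 0] billiard
      strictly_convex_closed_hypersurface_linear_image[OF T]
    unfolding finsler_billiard_orbit_def euclidean_billiard_orbit_def by auto
qed

end
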